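(* Define functions of $\tau$ in the upper half-plane by \[ \begin{aligned} g_1(\tau)&=\frac{\phi_1(\tau)^2}{\phi_1(2\tau)},\\ g_2(\tau)&=\phi_1(\tau)\phi_1(\tau/2)\phi_1(2\tau)-\frac{\phi_1(2\tau)}{\phi_2(\tau)},\\ g_3(\tau)&=-\phi_1(\tau)\phi_1(\tau/2)\phi_1(2\tau)-\frac{\phi_1(\tau)^2\phi_2(\tau)}{\phi_2(2\tau)}, \end{aligned} \] and let \[ P_{\upsilon}(T)=T^3+T^2-\frac{\upsilon^2-1}{\upsilon}T+\frac{(\upsilon-1)^2}{\upsilon}. \] Then \[ P_{\upsilon(\tau)}(T)=(T-g_1(\tau))(T-g_2(\tau))(T-g_3(\tau)). \] Equivalently, \[ g_1+g_2+g_3=-1,\qquad g_1g_2+g_2g_3+g_3g_1=-\upsilon+\frac1\upsilon,\qquad g_1g_2g_3=-\upsilon-\frac1\upsilon+2. \]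
   Context: For real $p,r$ let $\theta_{(p,r)}(z,\tau)=\sum_{n\in\mathbf Z}e^{\pi i(n+p)^2\tau+2\pi i(n+p)(z+r)}$ ($\tau$ in the upper half-plane, $z\in\mathbf C$), and put $\theta_k(z,\tau)=i^{-1}\theta_{(\frac12-\frac k7,\frac72)}(7z,7\tau)$. For $k=1,2,3$ set $a_k(\tau)=\theta_k(0,\tau)$; explicitly $a_k(\tau)=\sum_{n\in\mathbf Z}(-1)^{n+k+1}q^{(14n+7-2k)^2/56}$, where $q^r=e^{2\pi i r\tau}$. Define $\phi_1(\tau)=-a_3(\tau)/a_2(\tau)$, $\phi_2(\tau)=-a_2(\tau)/a_1(\tau)$, and $\upsilon(\tau)=a_2(\tau)^2a_3(\tau)/a_1(\tau)^3=\phi_1(\tau)\phi_2(\tau)^3$. *)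

theory Defs
  imports "HOL-Analysis.Analysis" "HOL-Computational_Algebra.Polynomial"
begin

definition theta_char :: "real \<Rightarrow> real \<Rightarrow> complex \<Rightarrow> complex \<Rightarrow> complex" where
  "theta_char p r z \<tau> =
     (\<Sum>\<^sub>\<infinity>n\<in>(UNIV :: int set).
        exp (of_real pi * \<i> * (of_int n + of_real p)\<^sup>2 * \<tau>
             + 2 * of_real pi * \<i> * (of_int n + of_real p) * (z + of_real r)))"

definition theta7 :: "nat \<Rightarrow> complex \<Rightarrow> complex \<Rightarrow> complex" where
  "theta7 k z \<tau> = inverse \<i> * theta_char (1/2 - real k / 7) (7/2) (7 * z) (7 * \<tau>)"

definition a7 :: "nat \<Rightarrow> complex \<Rightarrow> complex" where
  "a7 k \<tau> = theta7 k 0 \<tau>"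

definition phi1 :: "complex \<Rightarrow> complex" where
  "phi1 \<tau> = - (a7 3 \<tau> / a7 2 \<tau>)"

definition phi2 :: "complex \<Rightarrow> complex" where
  "phi2 \<tau> = - (a7 2 \<tau> / a7 1 \<tau>)"

definition upsilon :: "complex \<Rightarrow> complex" where
  "upsilon \<tau> = (a7 2 \<tau>)\<^sup>2 * a7 3 \<tau> / (a7 1 \<tau>) ^ 3"

definition g1 :: "complex \<Rightarrow> complex" where
  "g1 \<tau> = (phi1 \<tau>)\<^sup>2 / phi1 (2 * \<tau>)"

definition g2 :: "complex \<Rightarrow> complex" where
  "g2 \<tau> = phi1 \<tau> * phi1 (\<tau> / 2) * phi1 (2 * \<tau>) - phi1 (2 * \<tau>) / phi2 \<tau>"

definition g3 :: "complex \<Rightarrow> complex" where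
  "g3 \<tau> = - (phi1 \<tau> * phi1 (\<tau> / 2) * phi1 (2 * \<tau>))
          - (phi1 \<tau>)\<^sup>2 * phi2 \<tau> / phi2 (2 * \<tau>)"

definition P_poly :: "complex \<Rightarrow> complex poly" where
  "P_poly u = [: (u - 1)\<^sup>2 / u, - ((u\<^sup>2 - 1) / u), 1, 1 :]"

lemma poly_P_poly:
  "poly (P_poly u) T = T ^ 3 + T\<^sup>2 - (u\<^sup>2 - 1) / u * T + (u - 1)\<^sup>2 / u"
  by (simp add: P_poly_def algebra_simps power2_eq_square power3_eq_cube)

lemma upsilon_eq_phi: "upsilon \<tau> = phi1 \<tau> * phi2 \<tau> ^ 3"
  by (cases "a7 2 \<tau> = 0")
     (simp_all add: upsilon_def phi1_def phi2_def field_simps power2_eq_square power3_eq_cube)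

lemma a7_explicit:
  "a7 k \<tau> = (\<Sum>\<^sub>\<infinity>n\<in>(UNIV :: int set).
     (-1) powi (n + int k + 1)
     * exp (2 * of_real pi * \<i> * of_real (of_int ((14 * n + 7 - 2 * int k)\<^sup>2) / 56) * \<tau>))"
proof -
  have e: "inverse \<i> *
      exp (of_real pi * \<i> * (of_int n + of_real (1/2 - real k / 7))\<^sup>2 * (7 * \<tau>)
         + 2 * of_real pi * \<i> * (of_int n + of_real (1/2 - real k / 7)) * (7 * 0 + of_real (7/2)))
      = (-1) powi (n + int k + 1)
        * exp (2 * of_real pi * \<i> * of_real (of_int ((14 * n + 7 - 2 * int k)\<^sup>2) / 56) * \<tau>)"
    (is "_ * exp (?A + ?B) = ?s * exp ?C") for n
  proof -
    have A: "?A = ?C"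
      by (simp add: field_simps power2_eq_square)
    have "?B = of_real pi * \<i> * of_int (7 * n - int k + 4) + (- (of_real pi * \<i> / 2))"
      by (simp add: field_simps)
    hence "exp ?B = exp (of_real pi * \<i>) powi (7 * n - int k + 4) * exp (- (of_real pi * \<i> / 2))"
      by (simp only: exp_add exp_power_int) (simp add: mult_ac)
    also have "exp (- (of_real pi * \<i> / 2)) = -\<i>"
      by (simp add: complex_eq_iff Re_exp Im_exp)
    also have "exp (of_real pi * \<i>) powi (7 * n - int k + 4) = (-1) powi (n + int k)"
      by (simp add: power_int_minus_left)
    finally have "exp ?B = - \<i> * (-1) powi (n + int k)" by simp
    hence "inverse \<i> * exp (?A + ?B) = inverse \<i> * (exp ?C * (- \<i> * (-1) powi (n + int k)))"
      by (simp only: exp_add A)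
    also have "\<dots> = (inverse \<i> * - \<i>) * ((-1) powi (n + int k) * exp ?C)"
      by (simp only: mult_ac)
    also have "\<dots> = ?s * exp ?C"
      by (simp add: power_int_add)
    finally show ?thesis .
  qed
  have "a7 k \<tau> = (\<Sum>\<^sub>\<infinity>n\<in>(UNIV :: int set). inverse \<i> *
      exp (of_real pi * \<i> * (of_int n + of_real (1/2 - real k / 7))\<^sup>2 * (7 * \<tau>)
         + 2 * of_real pi * \<i> * (of_int n + of_real (1/2 - real k / 7)) * (7 * 0 + of_real (7/2))))"
    unfolding a7_def theta7_def theta_char_def by (rule infsum_cmult_right' [symmetric])
  thus ?thesis unfolding e .
qed

end

theory Submission
  imports Defs
begin

text \<open>
  Put \<open>h = exp (pi i tau)\<close>, \<open>p = h^14\<close> and let \<open>P\<close> be the theta product of nome \<open>p\<close>.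
  By the Jacobi triple product, \<open>a_k(tau)\<close> is proportional to \<open>a k = P(h^(2k))\<close>, which also shows that
  it does not vanish. The doubling identities for theta products turn \<open>tau \<mapsto> 2 tau\<close> into
  multiplication by \<open>b k = P(- h^(2k))\<close> and \<open>tau \<mapsto> tau / 2\<close> into multiplication by
  \<open>c k = P(h^(2k + 7))\<close>: on the curve with parameter \<open>7 tau\<close> these are translates of the
  7-torsion point \<open>tau\<close> by 2-torsion points.

  Weierstrass' three-term relation gives two quadrics through \<open>(b 1 : b 2 : b 3)\<close> with coefficients in the
  \<open>a k\<close>. Eliminating \<open>b 1\<close> shows that \<open>t = a 3 b 2 / (a 2 b 3)\<close>, which is \<open>g1\<close>, is a root of
  \<open>T^3 + (T - m) (T - n)\<close> with \<open>n = upsilon - 1\<close> (Klein's quartic) and \<open>m = n / upsilon\<close>; this is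
  \<open>P_upsilon\<close>. The rescaled \<open>c k\<close> lie on the same quadrics, so
  \<open>s = - a 3 c 2 / (h a 2 c 3)\<close> is a root as well, and it differs from \<open>t\<close>. Finally
  \<open>g1 + g2 + g3 = -1\<close> amounts to the cubic equation for \<open>t\<close>, and \<open>g3 = s\<close> to the
  relation between two distinct roots.
\<close>

section \<open>Theta series and the three-term relation\<close>

text \<open>The exponent n(n-1)/2 and the multiplicative variable \<open>x\<close> give the
  normalisation in which the sum over n is the triple product of (p;p), (x;p) and (p/x;p).\<close>

definition theta_term :: "complex \<Rightarrow> complex \<Rightarrow> int \<Rightarrow> complex" where
  "theta_term p x n = (-1) powi n * p powi (n * (n - 1) div 2) * x powi n"

definition theta_series :: "complex \<Rightarrow> complex \<Rightarrow> complex" where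
  "theta_series p x = (\<Sum>\<^sub>\<infinity>n. theta_term p x n)"

section \<open>Absolute convergence\<close>

lemma summable_on_intI:
  fixes f :: "int \<Rightarrow> real"
  assumes "summable (\<lambda>n. f (int n))" "summable (\<lambda>n. f (- int n))" "\<And>n. f n \<ge> 0"
  shows "f summable_on UNIV"
proof -
  have 1: "f summable_on range int"
    using assms by (subst summable_on_reindex) (auto simp: o_def summable_on_UNIV_nonneg_real_iff inj_on_def)
  have 2: "f summable_on range (\<lambda>n. - int n)"
    using assms by (subst summable_on_reindex) (auto simp: o_def summable_on_UNIV_nonneg_real_iff inj_on_def)
  have "n \<in> range int \<union> range (\<lambda>n. - int n)" for n
  proof (cases "n \<ge> 0")
    case True
    hence "n = int (nat n)" by simp
    thus ?thesis by blast
  next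
    case False
    hence "n = - int (nat (- n))" by simp
    thus ?thesis by blast
  qed
  hence "(UNIV :: int set) = range int \<union> range (\<lambda>n. - int n)" by blast
  thus ?thesis using summable_on_union[OF 1 2] by simp
qed

text \<open>Consecutive terms have ratio rho^n xi, which tends to 0 however large xi is.\<close>

lemma summable_quadratic_exponent:
  fixes \<rho> \<xi> :: real
  assumes "0 < \<rho>" "\<rho> < 1" "0 < \<xi>"
  shows "summable (\<lambda>n. \<rho> ^ (n * (n - 1) div 2) * \<xi> ^ n)"
proof -
  have "(\<lambda>n. \<rho> ^ n * \<xi>) \<longlonglongrightarrow> 0 * \<xi>"
    using assms by (intro tendsto_intros LIMSEQ_realpow_zero) auto
  hence "eventually (\<lambda>n. \<rho> ^ n * \<xi> < 1 / 2) sequentially"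
    by (rule order_tendstoD) auto
  then obtain N where N: "\<And>n. n \<ge> N \<Longrightarrow> \<rho> ^ n * \<xi> < 1 / 2"
    by (auto simp: eventually_at_top_linorder)
  show ?thesis
  proof (rule summable_ratio_test[of "1/2" N])
    fix n assume "N \<le> n"
    have e: "Suc n * (Suc n - 1) div 2 = n * (n - 1) div 2 + n"
    proof -
      have "Suc n * (Suc n - 1) = n * (n - 1) + n * 2"
        by (cases n) (auto simp: algebra_simps)
      thus ?thesis by simp
    qed
    have "\<rho> ^ (Suc n * (Suc n - 1) div 2) * \<xi> ^ Suc n =
        (\<rho> ^ n * \<xi>) * (\<rho> ^ (n * (n - 1) div 2) * \<xi> ^ n)"
      unfolding e by (simp add: power_add)
    also have "\<dots> \<le> 1 / 2 * (\<rho> ^ (n * (n - 1) div 2) * \<xi> ^ n)"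
      using N[OF \<open>N \<le> n\<close>] assms by (intro mult_right_mono) auto
    finally show "norm (\<rho> ^ (Suc n * (Suc n - 1) div 2) * \<xi> ^ Suc n) \<le>
        1 / 2 * norm (\<rho> ^ (n * (n - 1) div 2) * \<xi> ^ n)"
      using assms by simp
  qed auto
qed

lemma abs_summable_theta_term:
  assumes "p \<noteq> 0" "norm p < 1" "x \<noteq> 0"
  shows "(\<lambda>n. norm (theta_term p x n)) summable_on UNIV"
proof (rule summable_on_intI)
  have pos: "0 < norm p" "0 < norm x" "0 < norm p / norm x" using assms by auto
  have "norm (theta_term p x (int n)) = norm p ^ (n * (n - 1) div 2) * norm x ^ n" for n
  proof -
    have "int n * (int n - 1) div 2 = int (n * (n - 1) div 2)"
      by (cases n) (auto simp: zdiv_int algebra_simps)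
    thus ?thesis by (simp add: theta_term_def norm_mult norm_power norm_power_int)
  qed
  thus "summable (\<lambda>n. norm (theta_term p x (int n)))"
    using summable_quadratic_exponent[OF pos(1) assms(2) pos(2)] by simp
  \<comment> \<open>Replacing n by -n turns n(n-1)/2 into n(n-1)/2 + n, so the negative half is the
    positive half with \<open>norm x\<close> replaced by \<open>norm p / norm x\<close>.\<close>
  have "norm (theta_term p x (- int n)) = norm p ^ (n * (n - 1) div 2) * (norm p / norm x) ^ n" for n
  proof -
    have "n * (n - 1) + n * 2 = n * (n + 1)" by (cases n) (auto simp: algebra_simps)
    hence "n * (n + 1) div 2 = n * (n - 1) div 2 + n" by linarith
    moreover have "- int n * (- int n - 1) div 2 = int (n * (n + 1) div 2)"
      by (simp add: zdiv_int algebra_simps)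
    ultimately have "- int n * (- int n - 1) div 2 = int (n * (n - 1) div 2 + n)" by simp
    hence "theta_term p x (- int n) = (-1) powi (- int n) * (p ^ (n * (n - 1) div 2) * p ^ n) * x powi (- int n)"
      by (simp only: theta_term_def power_int_of_nat power_add)
    thus ?thesis
      by (simp add: norm_mult norm_inverse norm_power power_int_minus power_divide divide_inverse power_mult_distrib power_inverse)
  qed
  thus "summable (\<lambda>n. norm (theta_term p x (- int n)))"
    using summable_quadratic_exponent[OF pos(1) assms(2) pos(3)] by simp
qed auto

lemma abs_summable_square_exponent:
  fixes r x :: complex
  assumes "r \<noteq> 0" "norm r < 1" "x \<noteq> 0"
  shows "(\<lambda>n::int. norm (r powi (n ^ 2) * x powi n)) summable_on UNIV"
proof -
  have "norm (theta_term (r ^ 2) (r * x) n) = norm (r powi (n ^ 2) * x powi n)" for n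
  proof -
    have "2 * (n * (n - 1) div 2) = n * (n - 1)" by simp
    hence "(r ^ 2) powi (n * (n - 1) div 2) = r powi (n * (n - 1))"
      by (metis power_int_mult power_int_numeral)
    moreover have "r powi (n * (n - 1)) * r powi n = r powi (n ^ 2)"
      using assms by (subst power_int_add[symmetric]) (auto simp: power2_eq_square algebra_simps)
    ultimately show ?thesis
      using assms by (simp add: theta_term_def norm_mult norm_power_int power_int_mult_distrib)
        (metis mult.assoc norm_mult norm_power_int)
  qed
  moreover have "norm (r ^ 2) < 1" using assms by (simp add: norm_power power_less_one_iff)
  ultimately show ?thesis
    using abs_summable_theta_term[of "r ^ 2" "r * x"] assms by simp
qed

text \<open>The even and odd halves of the sum of r^(n^2) x^n are the classical theta_3 and theta_2
  of nome r^4; products of two theta series are bilinear in them.\<close>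

definition theta_even :: "complex \<Rightarrow> complex \<Rightarrow> complex" where
  "theta_even r x = (\<Sum>\<^sub>\<infinity>n. r powi ((2 * n) ^ 2) * x powi (2 * n))"

definition theta_odd :: "complex \<Rightarrow> complex \<Rightarrow> complex" where
  "theta_odd r x = (\<Sum>\<^sub>\<infinity>n. r powi ((2 * n + 1) ^ 2) * x powi (2 * n + 1))"

lemma abs_summable_theta_even_odd:
  fixes r x :: complex
  assumes "r \<noteq> 0" "norm r < 1" "x \<noteq> 0"
  shows "(\<lambda>n. norm (r powi ((2 * n) ^ 2) * x powi (2 * n))) summable_on UNIV"
    and "(\<lambda>n. norm (r powi ((2 * n + 1) ^ 2) * x powi (2 * n + 1))) summable_on UNIV"
proof -
  note s = abs_summable_square_exponent[OF assms]
  have "(\<lambda>n. norm (r powi (n ^ 2) * x powi n)) summable_on range (\<lambda>n. 2 * n)"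
    by (rule summable_on_subset_banach[OF s]) auto
  thus "(\<lambda>n. norm (r powi ((2 * n) ^ 2) * x powi (2 * n))) summable_on UNIV"
    by (subst (asm) summable_on_reindex) (auto simp: o_def inj_on_def)
  have "(\<lambda>n. norm (r powi (n ^ 2) * x powi n)) summable_on range (\<lambda>n. 2 * n + 1)"
    by (rule summable_on_subset_banach[OF s]) auto
  thus "(\<lambda>n. norm (r powi ((2 * n + 1) ^ 2) * x powi (2 * n + 1))) summable_on UNIV"
    by (subst (asm) summable_on_reindex) (auto simp: o_def inj_on_def)
qed

lemma has_sum_product:
  fixes f g :: "int \<Rightarrow> complex"
  assumes "(\<lambda>n. norm (f n)) summable_on UNIV" "(\<lambda>n. norm (g n)) summable_on UNIV"
  shows "((\<lambda>(i, j). f i * g j) has_sum infsum f UNIV * infsum g UNIV) UNIV"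
proof -
  have f: "(f has_sum infsum f UNIV) UNIV" by (rule has_sum_infsum[OF abs_summable_summable[OF assms(1)]])
  have g: "(g has_sum infsum g UNIV) UNIV" by (rule has_sum_infsum[OF abs_summable_summable[OF assms(2)]])
  have "(\<lambda>(i, j). f i * g j) summable_on UNIV \<times> UNIV"
  proof (rule abs_summable_summable, rule summable_on_SigmaI)
    fix i :: int
    show "((\<lambda>j. norm (case (i, j) of (i, j) \<Rightarrow> f i * g j)) has_sum
        norm (f i) * (\<Sum>\<^sub>\<infinity>j. norm (g j))) UNIV"
      using assms by (auto simp: norm_mult intro!: has_sum_cmult_right)
  qed (use assms in \<open>auto intro!: summable_on_cmult_left\<close>)
  hence "((\<lambda>(i, j). f i * g j) has_sum infsum f UNIV * infsum g UNIV) (UNIV \<times> UNIV)"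
    by (rule has_sum_SigmaI[rotated 2])
       (use f g in \<open>auto intro!: has_sum_cmult_left has_sum_cmult_right\<close>)
  thus ?thesis by simp
qed

text \<open>The exponent 2m(m-1) + 2n(n-1) separates in m + n and m - n. Taking the nome as a fourth
  power keeps all exponents of \<open>r\<close> integral.\<close>

lemma theta_term_mult:
  assumes "r \<noteq> 0" "x \<noteq> 0" "y \<noteq> 0"
  shows "theta_term (r ^ 4) (x * y) m * theta_term (r ^ 4) (x / y) n =
    (-1) powi (m + n) * r powi ((m + n - 1) ^ 2 - 1 + (m - n) ^ 2) * x powi (m + n) * y powi (m - n)"
proof -
  have q: "(r ^ 4) powi (k * (k - 1) div 2) = r powi (2 * k * (k - 1))" for k :: int
  proof -
    have "4 * (k * (k - 1) div 2) = 2 * (2 * (k * (k - 1) div 2))" by simp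
    also have "2 * (k * (k - 1) div 2) = k * (k - 1)" by simp
    finally have "4 * (k * (k - 1) div 2) = 2 * k * (k - 1)" by simp
    thus ?thesis by (metis power_int_mult power_int_numeral)
  qed
  have e: "2 * m * (m - 1) + 2 * n * (n - 1) = (m + n - 1) ^ 2 - 1 + (m - n) ^ 2"
    by (simp add: power2_eq_square algebra_simps)
  have 1: "r powi (2 * m * (m - 1)) * r powi (2 * n * (n - 1)) = r powi ((m + n - 1) ^ 2 - 1 + (m - n) ^ 2)"
    using assms by (simp only: e[symmetric]) (simp add: power_int_add)
  have 2: "x powi m * x powi n = x powi (m + n)" "(-1) powi m * (-1) powi n = ((-1) powi (m + n) :: complex)"
    "y powi m / y powi n = y powi (m - n)"
    using assms by (simp_all add: power_int_add power_int_diff)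
  show ?thesis
    unfolding theta_term_def q power_int_mult_distrib power_int_divide_distrib 1[symmetric] 2[symmetric]
    by (simp only: times_divide_eq_left times_divide_eq_right mult_ac)
qed

text \<open>
  The product is a \<open>2 \<times> 2\<close> determinant in the vectors (odd part, even part) at \<open>x\<close> and \<open>y\<close>,
  so Weierstrass' relation is the Grassmann relation for such determinants.
\<close>

lemma theta_series_mult:
  assumes "r \<noteq> 0" "norm r < 1" "x \<noteq> 0" "y \<noteq> 0"
  shows "theta_series (r ^ 4) (x * y) * theta_series (r ^ 4) (x / y) =
    x / r * (theta_odd r x * theta_even r y - theta_even r x * theta_odd r y)"
proof -
  define f where "f = (\<lambda>(m, n). theta_term (r ^ 4) (x * y) m * theta_term (r ^ 4) (x / y) n)"
  define E where "E = (\<lambda>z n. r powi ((2 * n) ^ 2) * z powi (2 * n))"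
  define V where "V = (\<lambda>z n. r powi ((2 * n + 1) ^ 2) * z powi (2 * n + 1))"
  have pow: "z powi (k + l) = z powi k * z powi l" "z powi (k - l) = z powi k / z powi l"
    if "z \<noteq> 0" for z :: complex and k l
    using that by (simp_all add: power_int_add power_int_diff)
  have "norm (r ^ 4) < 1" using assms by (simp add: norm_power power_less_one_iff)
  hence f: "(f has_sum theta_series (r ^ 4) (x * y) * theta_series (r ^ 4) (x / y)) UNIV"
    unfolding f_def theta_series_def using assms
    by (intro has_sum_product abs_summable_theta_term) auto
  \<comment> \<open>Here m + n - 1 = 2i + 1 and m - n = 2j, so \<open>x\<close> gets the odd half
    and \<open>y\<close> the even half. The factor x / r comes from the offsets in x^(m+n) and in
    the exponent of \<open>r\<close>.\<close>
  have "(f has_sum x / r * (theta_odd r x * theta_even r y)) {(m, n). even (m + n)}"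
  proof -
    have "((\<lambda>(i, j). V x i * E y j) has_sum theta_odd r x * theta_even r y) UNIV"
      unfolding theta_even_def theta_odd_def E_def V_def
      by (intro has_sum_product abs_summable_theta_even_odd assms)
    hence "((\<lambda>z. x / r * (case z of (i, j) \<Rightarrow> V x i * E y j)) has_sum x / r * (theta_odd r x * theta_even r y)) UNIV"
      by (rule has_sum_cmult_right)
    also have "?this \<longleftrightarrow> ?thesis"
    proof (rule has_sum_reindex_bij_witness[where i = "\<lambda>(m, n). ((m + n) div 2 - 1, (m - n) div 2)"
          and j = "\<lambda>(i, j). (i + 1 + j, i + 1 - j)"])
      fix z :: "int \<times> int"
      obtain i j where [simp]: "z = (i, j)" by force
      have "f (i + 1 + j, i + 1 - j) = r powi ((2 * i + 1) ^ 2 - 1 + (2 * j) ^ 2) * x powi (2 * i + 1 + 1) * y powi (2 * j)"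
        unfolding f_def using assms by (simp add: theta_term_mult algebra_simps)
      also have "\<dots> = x / r * (V x i * E y j)"
        unfolding V_def E_def pow[OF assms(1)] pow[OF assms(3)] pow[OF assms(4)] using assms(1,3,4) by simp
      finally show "f (case z of (i, j) \<Rightarrow> (i + 1 + j, i + 1 - j)) = x / r * (case z of (i, j) \<Rightarrow> V x i * E y j)"
        by simp
    qed (simp_all split: prod.splits, presburger+)
    finally show ?thesis .
  qed
  \<comment> \<open>Now m + n - 1 = 2i and m - n = 2j + 1: the roles are exchanged, and (-1)^(m+n)
    supplies the minus sign.\<close>
  moreover have "(f has_sum - (x / r) * (theta_even r x * theta_odd r y)) {(m, n). odd (m + n)}"
  proof -
    have "((\<lambda>(i, j). E x i * V y j) has_sum theta_even r x * theta_odd r y) UNIV"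
      unfolding theta_even_def theta_odd_def E_def V_def
      by (intro has_sum_product abs_summable_theta_even_odd assms)
    hence "((\<lambda>z. - (x / r) * (case z of (i, j) \<Rightarrow> E x i * V y j)) has_sum - (x / r) * (theta_even r x * theta_odd r y)) UNIV"
      by (rule has_sum_cmult_right)
    also have "?this \<longleftrightarrow> ?thesis"
    proof (rule has_sum_reindex_bij_witness[where i = "\<lambda>(m, n). ((m + n) div 2, (m - n) div 2)"
          and j = "\<lambda>(i, j). (i + 1 + j, i - j)"])
      fix z :: "int \<times> int"
      obtain i j where [simp]: "z = (i, j)" by force
      have "f (i + 1 + j, i - j) = - (r powi ((2 * i) ^ 2 - 1 + (2 * j + 1) ^ 2) * x powi (2 * i + 1) * y powi (2 * j + 1))"
        unfolding f_def using assms by (simp add: theta_term_mult algebra_simps)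
      also have "\<dots> = - (x / r) * (E x i * V y j)"
        unfolding V_def E_def pow[OF assms(1)] pow[OF assms(3)] pow[OF assms(4)] using assms(1,3,4) by simp
      finally show "f (case z of (i, j) \<Rightarrow> (i + 1 + j, i - j)) = - (x / r) * (case z of (i, j) \<Rightarrow> E x i * V y j)"
        by simp
    qed (simp_all split: prod.splits, presburger+)
    finally show ?thesis .
  qed
  ultimately have "(f has_sum x / r * (theta_odd r x * theta_even r y) + - (x / r) * (theta_even r x * theta_odd r y))
      ({(m, n). even (m + n)} \<union> {(m, n). odd (m + n)})"
    by (intro has_sum_Un_disjoint) auto
  also have "{(m, n). even (m + n)} \<union> {(m, n). odd (m + n)} = (UNIV :: (int \<times> int) set)"
    by auto
  finally have "theta_series (r ^ 4) (x * y) * theta_series (r ^ 4) (x / y) =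
      x / r * (theta_odd r x * theta_even r y) + - (x / r) * (theta_even r x * theta_odd r y)"
    using f by (rule has_sum_unique[rotated])
  thus ?thesis by (simp add: algebra_simps)
qed

lemma theta_series_weierstrass:
  assumes "p \<noteq> 0" "norm p < 1" "x \<noteq> 0" "y \<noteq> 0" "u \<noteq> 0" "v \<noteq> 0"
  defines "T \<equiv> theta_series p"
  shows "T (x * y) * T (x / y) * T (u * v) * T (u / v) - T (x * v) * T (x / v) * T (u * y) * T (u / y)
    = u / y * (T (y * v) * T (y / v) * T (x * u) * T (x / u))"
proof -
  define r where "r = csqrt (csqrt p)"
  have "r ^ 4 = (r ^ 2) ^ 2" by simp
  hence r4: "r ^ 4 = p" unfolding r_def by (simp only: power2_csqrt)
  hence r: "r \<noteq> 0" "norm r < 1"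
    using assms by (auto simp: norm_power power_less_one_iff)
  have M: "T (z * w) * T (z / w) = z / r * (theta_odd r z * theta_even r w - theta_even r z * theta_odd r w)"
    if "z \<noteq> 0" "w \<noteq> 0" for z w
    using theta_series_mult[OF r that] by (simp add: T_def r4)
  \<comment> \<open>With every pair written as a determinant, the prefactors on both sides amount to
    x u / r^2; the factor u / y corrects the \<open>y\<close> that stands in place of
    \<open>u\<close> on the right.\<close>
  have "T (x * y) * T (x / y) * (T (u * v) * T (u / v)) - T (x * v) * T (x / v) * (T (u * y) * T (u / y))
    = u / y * (T (y * v) * T (y / v) * (T (x * u) * T (x / u)))"
    unfolding M[OF assms(3,4)] M[OF assms(5,6)] M[OF assms(3,6)] M[OF assms(5,4)] M[OF assms(4,6)] M[OF assms(3,5)]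
    using assms(3-6) r by (simp add: field_simps)
  thus ?thesis by (simp add: mult_ac)
qed

lemma theta_series_quasiperiod:
  assumes "p \<noteq> 0" "x \<noteq> 0"
  shows "theta_series p (p * x) = - theta_series p x / x"
proof -
  have "theta_series p x = (\<Sum>\<^sub>\<infinity>n. - x * theta_term p (p * x) n)"
    unfolding theta_series_def
  proof (rule infsum_reindex_bij_witness[where i = "\<lambda>n. n + 1" and j = "\<lambda>n. n - 1"])
    fix n :: int
    have "n * (n - 1) div 2 = (n - 1) * (n - 1 - 1) div 2 + (n - 1)"
    proof -
      have "n * (n - 1) = (n - 1) * (n - 1 - 1) + (n - 1) * 2" by (simp add: algebra_simps)
      thus ?thesis by simp
    qed
    hence "p powi (n * (n - 1) div 2) = p powi ((n - 1) * (n - 1 - 1) div 2) * p powi (n - 1)"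
      using assms by (simp add: power_int_add)
    moreover have "x powi n = x * x powi (n - 1)" "(-1) powi n = - ((-1) powi (n - 1) :: complex)"
      using assms by (simp_all add: power_int_diff)
    ultimately show "- x * theta_term p (p * x) (n - 1) = theta_term p x n"
      unfolding theta_term_def by (simp add: power_int_mult_distrib)
  qed auto
  also have "\<dots> = - x * theta_series p (p * x)"
    unfolding theta_series_def by (rule infsum_cmult_right')
  finally show ?thesis using assms by (simp add: field_simps)
qed

text \<open>Reversing the summation index exchanges 1/x with p x; the quasi-period then removes
  \<open>p\<close>.\<close>

lemma theta_series_inverse:
  assumes "p \<noteq> 0" "x \<noteq> 0"
  shows "theta_series p (1 / x) = - theta_series p x / x"
proof -
  have "theta_series p (p * x) = theta_series p (1 / x)"
    unfolding theta_series_def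
  proof (rule infsum_reindex_bij_witness[where i = "\<lambda>n. - n" and j = "\<lambda>n. - n"])
    fix n :: int
    have "- n * (- n - 1) div 2 = n * (n - 1) div 2 + n"
    proof -
      have "- n * (- n - 1) = n * (n - 1) + n * 2" by (simp add: algebra_simps)
      thus ?thesis by simp
    qed
    hence "p powi (- n * (- n - 1) div 2) = p powi (n * (n - 1) div 2) * p powi n"
      using assms by (simp add: power_int_add)
    thus "theta_term p (1 / x) (- n) = theta_term p (p * x) n"
      unfolding theta_term_def
      by (simp add: power_int_mult_distrib power_int_minus power_int_divide_distrib field_simps)
  qed auto
  thus ?thesis using theta_series_quasiperiod[OF assms] by simp
qed

section \<open>The Jacobi triple product\<close>

text \<open>The Euler factor (p;p) is left out, since it cancels from quotients and from homogeneous
  identities.\<close>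

definition theta_prod :: "complex \<Rightarrow> complex \<Rightarrow> complex" where
  "theta_prod p x = (\<Prod>n. (1 - p ^ n * x) * (1 - p ^ Suc n / x))"

section \<open>Gaussian binomials and the finite triple product\<close>

definition qpoch :: "complex \<Rightarrow> nat \<Rightarrow> complex" where
  "qpoch p n = (\<Prod>i<n. 1 - p ^ Suc i)"

definition qbinomial :: "complex \<Rightarrow> nat \<Rightarrow> nat \<Rightarrow> complex" where
  "qbinomial p n k = (if k \<le> n then qpoch p n / (qpoch p k * qpoch p (n - k)) else 0)"

lemma one_minus_power_nonzero:
  fixes p :: complex
  assumes "norm p < 1" "n > 0"
  shows "1 - p ^ n \<noteq> 0"
proof
  assume "1 - p ^ n = 0"
  hence "norm p ^ n = 1" by (metis eq_iff_diff_eq_0 norm_one norm_power)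
  thus False using assms power_less_one_iff[of "norm p" n] by simp
qed

lemma qpoch_nonzero: "norm p < 1 \<Longrightarrow> qpoch p n \<noteq> 0"
  unfolding qpoch_def using one_minus_power_nonzero[of p "Suc i" for i] by simp

lemma qpoch_0 [simp]: "qpoch p 0 = 1"
  by (simp add: qpoch_def)

lemma qbinomial_0: "norm p < 1 \<Longrightarrow> qbinomial p n 0 = 1"
  using qpoch_nonzero[of p n] by (simp add: qbinomial_def)

text \<open>With n = k + d + 1, this q-Pascal rule is the splitting of 1 - p^(n+1) into (1 -
  p^(d+1)) + p^(d+1) (1 - p^(k+1)). For k = n the first summand on the right is 0 by
  definition.\<close>

lemma qbinomial_Suc_Suc:
  assumes "norm p < 1" "k \<le> n"
  shows "qbinomial p (Suc n) (Suc k) = qbinomial p n (Suc k) + p ^ (n - k) * qbinomial p n k"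
proof (cases "k = n")
  case True
  thus ?thesis using qpoch_nonzero[OF assms(1), of n] qpoch_nonzero[OF assms(1), of "Suc n"]
    by (simp add: qbinomial_def)
next
  case False
  then obtain d where d: "n = k + Suc d" using assms by (metis less_iff_Suc_add nat_less_le add_Suc_right)
  have S: "qpoch p (Suc m) = qpoch p m * (1 - p ^ Suc m)" for m by (simp add: qpoch_def)
  have e: "1 - p ^ Suc n = (1 - p ^ Suc d) + p ^ Suc d * (1 - p ^ Suc k)"
    by (simp add: d algebra_simps power_add)
  have nz: "qpoch p k \<noteq> 0" "qpoch p d \<noteq> 0" "1 - p ^ Suc k \<noteq> 0" "1 - p ^ Suc d \<noteq> 0"
    using qpoch_nonzero one_minus_power_nonzero assms by blast+
  have gen: "N * (D + P * K) / (a * K * (b * D)) = N / (a * K * b) + P * (N / (a * (b * D)))"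
    if "a \<noteq> 0" "b \<noteq> 0" "K \<noteq> 0" "D \<noteq> 0" for N D P K a b :: complex
    using that by (simp add: field_simps)
  have "qbinomial p (Suc n) (Suc k) = qpoch p n * (1 - p ^ Suc n) / (qpoch p k * (1 - p ^ Suc k) * (qpoch p d * (1 - p ^ Suc d)))"
    by (simp add: qbinomial_def d S)
  also have "\<dots> = qpoch p n / (qpoch p k * (1 - p ^ Suc k) * qpoch p d) + p ^ Suc d * (qpoch p n / (qpoch p k * (qpoch p d * (1 - p ^ Suc d))))"
    unfolding e by (rule gen) (use nz in auto)
  also have "\<dots> = qbinomial p n (Suc k) + p ^ (n - k) * qbinomial p n k"
    by (simp add: qbinomial_def d S)
  finally show ?thesis .
qed

text \<open>By the q-Pascal rule the sum for n + 1 is the sum for n plus y p^n times the sum for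
  n.\<close>

lemma q_binomial_theorem:
  assumes "norm p < 1"
  shows "(\<Prod>i<n. 1 + y * p ^ i) = (\<Sum>k\<le>n. p ^ (k * (k - 1) div 2) * y ^ k * qbinomial p n k)"
proof (induction n)
  case 0
  thus ?case by (simp add: qbinomial_def qpoch_def)
next
  case (Suc n)
  define c where "c k = p ^ (k * (k - 1) div 2) * y ^ k" for k
  have c: "c (Suc k) = c k * y * p ^ k" for k
  proof -
    have "Suc k * (Suc k - 1) = k * (k - 1) + k * 2" by (cases k) (auto simp: algebra_simps)
    hence "Suc k * (Suc k - 1) div 2 = k * (k - 1) div 2 + k" by simp
    thus ?thesis by (simp only: c_def power_add) simp
  qed
  have "(\<Sum>k\<le>Suc n. c k * qbinomial p (Suc n) k) =
      c 0 * 1 + (\<Sum>k\<le>n. c (Suc k) * (qbinomial p n (Suc k) + p ^ (n - k) * qbinomial p n k))"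
    using assms by (subst sum.atMost_Suc_shift) (simp add: qbinomial_Suc_Suc qbinomial_0)
  also have "\<dots> = (c 0 * qbinomial p n 0 + (\<Sum>k\<le>n. c (Suc k) * qbinomial p n (Suc k)))
      + (\<Sum>k\<le>n. c (Suc k) * (p ^ (n - k) * qbinomial p n k))"
    using assms by (simp add: algebra_simps sum.distrib qbinomial_0)
  also have "c 0 * qbinomial p n 0 + (\<Sum>k\<le>n. c (Suc k) * qbinomial p n (Suc k)) = (\<Sum>k\<le>Suc n. c k * qbinomial p n k)"
    by (subst sum.atMost_Suc_shift) simp
  also have "\<dots> = (\<Sum>k\<le>n. c k * qbinomial p n k)"
    by (simp add: qbinomial_def)
  also have "(\<Sum>k\<le>n. c (Suc k) * (p ^ (n - k) * qbinomial p n k)) = y * p ^ n * (\<Sum>k\<le>n. c k * qbinomial p n k)"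
    unfolding sum_distrib_left
  proof (rule sum.cong)
    fix k assume "k \<in> {..n}"
    hence "p ^ n = p ^ k * p ^ (n - k)" by (simp flip: power_add)
    thus "c (Suc k) * (p ^ (n - k) * qbinomial p n k) = y * p ^ n * (c k * qbinomial p n k)"
      by (simp add: c mult_ac)
  qed simp
  finally show ?case using Suc.IH by (simp add: c_def algebra_simps)
qed

lemma prod_lessThan_add:
  fixes f :: "nat \<Rightarrow> 'a :: comm_monoid_mult"
  shows "(\<Prod>i<m + n. f i) = (\<Prod>i<m. f i) * (\<Prod>i<n. f (m + i))"
  by (induction n) (simp_all add: mult_ac)

text \<open>Take 2n factors in the q-binomial theorem at y = - x / p^n. The last n factors are 1 -
  p^i x; the first n, in reverse order, are - x / p^(i+1) times 1 - p^(i+1) / x, and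
  \<open>K\<close> collects these prefactors.\<close>

lemma finite_jacobi_triple_product:
  assumes "p \<noteq> 0" "norm p < 1" "x \<noteq> 0"
  shows "(\<Prod>i<n. (1 - p ^ i * x) * (1 - p ^ Suc i / x)) =
    (\<Sum>k\<le>2 * n. theta_term p x (int k - int n) * qbinomial p (2 * n) k)"
proof -
  define K where "K = (\<Prod>i<n. - x / p ^ Suc i)"
  have "K \<noteq> 0" using assms by (simp add: K_def)
  have K: "K = (-x) ^ n * p powi (- (int n * (int n + 1) div 2))"
    unfolding K_def
  proof (induction n)
    case (Suc n)
    have "int (Suc n) * (int (Suc n) + 1) = int n * (int n + 1) + int (Suc n) * 2"
      by (simp add: algebra_simps)
    hence "int (Suc n) * (int (Suc n) + 1) div 2 = int n * (int n + 1) div 2 + int (Suc n)" by simp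
    hence "p powi (- (int (Suc n) * (int (Suc n) + 1) div 2)) = p powi (- (int n * (int n + 1) div 2)) / p ^ Suc n"
      using power_int_add[of p "- (int n * (int n + 1) div 2)" "- int (Suc n)"] assms(1)
      by (simp only: minus_add_distrib power_int_minus[of p "int (Suc n)"] power_int_of_nat divide_inverse) blast
    thus ?case using Suc.IH by (simp only: prod.lessThan_Suc) simp
  qed simp
  \<comment> \<open>Dividing by \<open>K\<close> recentres the sum at k = n: k(k-1)/2 - nk is -
    n(n+1)/2 plus the triangular exponent of k - n.\<close>
  have coeff: "p ^ (k * (k - 1) div 2) * (- x / p ^ n) ^ k = K * theta_term p x (int k - int n)" for k
  proof -
    have "int (k * (k - 1) div 2) = int k * (int k - 1) div 2"
      by (cases k) (auto simp: zdiv_int algebra_simps)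
    hence 1: "p ^ (k * (k - 1) div 2) = p powi (int k * (int k - 1) div 2)"
      by (metis power_int_of_nat)
    have 2: "int k * (int k - 1) div 2 - int n * int k =
        - (int n * (int n + 1) div 2) + (int k - int n) * (int k - int n - 1) div 2"
    proof -
      have ev: "2 * (a * (a - 1) div 2) = a * (a - 1)" for a :: int by simp
      have "2 * (int k * (int k - 1) div 2) = int k * (int k - 1)" "2 * (int n * (int n + 1) div 2) = int n * (int n + 1)"
        "2 * ((int k - int n) * (int k - int n - 1) div 2) = (int k - int n) * (int k - int n - 1)"
        using ev[of "int k"] ev[of "int n + 1"] ev[of "int k - int n"] by (simp_all add: mult.commute)
      moreover have "int k * (int k - 1) - 2 * (int n * int k) = - (int n * (int n + 1)) + (int k - int n) * (int k - int n - 1)"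
        by (simp add: algebra_simps)
      ultimately show ?thesis by linarith
    qed
    have "p powi (int k * (int k - 1) div 2) / p powi (int n * int k) = p powi (int k * (int k - 1) div 2 - int n * int k)"
      using assms by (simp add: power_int_diff)
    also have "\<dots> = p powi (- (int n * (int n + 1) div 2)) * p powi ((int k - int n) * (int k - int n - 1) div 2)"
      unfolding 2 using assms by (intro power_int_add) simp
    finally have 3: "p powi (int k * (int k - 1) div 2) / p powi (int n * int k) =
        p powi (- (int n * (int n + 1) div 2)) * p powi ((int k - int n) * (int k - int n - 1) div 2)" .
    have "(- x / p ^ n) ^ k = (- x) ^ k / p powi (int n * int k)"
      by (simp only: power_divide power_int_mult power_int_of_nat)
    hence "p ^ (k * (k - 1) div 2) * (- x / p ^ n) ^ k =
        (- x) ^ k * (p powi (- (int n * (int n + 1) div 2)) * p powi ((int k - int n) * (int k - int n - 1) div 2))"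
      unfolding 1 3[symmetric] by simp
    also have "(- x) ^ k = (- x) ^ n * (- x) powi (int k - int n)"
      using assms by (simp add: power_int_diff)
    also have "(- x) powi (int k - int n) = (-1) powi (int k - int n) * x powi (int k - int n)"
      by (metis mult_minus1 power_int_mult_distrib)
    finally show ?thesis by (simp only: K theta_term_def mult_ac)
  qed
  have "(\<Prod>i<2 * n. 1 + (- x / p ^ n) * p ^ i) = (\<Prod>i<n. 1 + (- x / p ^ n) * p ^ i) * (\<Prod>i<n. 1 + (- x / p ^ n) * p ^ (n + i))"
    by (simp only: mult_2 prod_lessThan_add)
  also have "(\<Prod>i<n. 1 + (- x / p ^ n) * p ^ (n + i)) = (\<Prod>i<n. 1 - p ^ i * x)"
    using assms by (intro prod.cong) (auto simp: power_add)
  also have "(\<Prod>i<n. 1 + (- x / p ^ n) * p ^ i) = (\<Prod>i<n. 1 + (- x / p ^ n) * p ^ (n - Suc i))"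
    by (rule prod.nat_diff_reindex[symmetric])
  also have "\<dots> = (\<Prod>i<n. - x / p ^ Suc i * (1 - p ^ Suc i / x))"
  proof (rule prod.cong)
    fix i assume "i \<in> {..<n}"
    hence "p ^ n = p ^ (n - Suc i) * p ^ Suc i"
      by (metis lessThan_iff Suc_leI le_add_diff_inverse2 power_add)
    thus "1 + (- x / p ^ n) * p ^ (n - Suc i) = - x / p ^ Suc i * (1 - p ^ Suc i / x)"
      using assms by (simp add: field_simps)
  qed simp
  also have "\<dots> = K * (\<Prod>i<n. 1 - p ^ Suc i / x)"
    unfolding K_def by (rule prod.distrib)
  finally have "K * (\<Prod>i<n. (1 - p ^ i * x) * (1 - p ^ Suc i / x)) = (\<Prod>i<2 * n. 1 + (- x / p ^ n) * p ^ i)"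
    by (simp only: prod.distrib mult_ac)
  also have "\<dots> = (\<Sum>k\<le>2 * n. K * theta_term p x (int k - int n) * qbinomial p (2 * n) k)"
    unfolding q_binomial_theorem[OF assms(2)] by (simp only: coeff)
  also have "\<dots> = K * (\<Sum>k\<le>2 * n. theta_term p x (int k - int n) * qbinomial p (2 * n) k)"
    by (simp add: sum_distrib_left mult_ac)
  finally show ?thesis using \<open>K \<noteq> 0\<close> by simp
qed

section \<open>Passage to the limit\<close>

lemma tendsto_infsum_dominated:
  fixes f :: "nat \<Rightarrow> 'a \<Rightarrow> 'b :: banach"
  assumes "\<And>x. (\<lambda>n. f n x) \<longlonglongrightarrow> g x" "\<And>n x. norm (f n x) \<le> M x" "M summable_on UNIV"
  shows "(\<lambda>n. infsum (f n) UNIV) \<longlonglongrightarrow> infsum g UNIV"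
\<comment> \<open>Dominated convergence as an exchange of limits: by the M-test the finite partial
  sums converge uniformly in \<open>n\<close>.\<close>
proof (rule swap_uniform_limit')
  show "uniform_limit UNIV (\<lambda>X n. \<Sum>x\<in>X. f n x) (\<lambda>n. infsum (f n) UNIV) (finite_subsets_at_top UNIV)"
    using assms by (intro Weierstrass_m_test_general) auto
  show "\<forall>\<^sub>F X in finite_subsets_at_top UNIV. (\<lambda>n. \<Sum>x\<in>X. f n x) \<longlonglongrightarrow> (\<Sum>x\<in>X. g x)"
    using assms by (intro always_eventually allI tendsto_sum)
  have "norm (g x) \<le> M x" for x
    using assms(1)[of x] assms(2)[of _ x] by (intro Lim_bounded[OF tendsto_norm]) auto
  hence "(\<lambda>x. norm (g x)) summable_on UNIV"
    by (rule Infinite_Sum.abs_summable_on_comparison_test'[OF assms(3)])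
  hence "(g has_sum infsum g UNIV) UNIV"
    using abs_summable_summable by (intro has_sum_infsum) blast
  thus "((\<lambda>X. \<Sum>x\<in>X. g x) \<longlongrightarrow> infsum g UNIV) (finite_subsets_at_top UNIV)"
    by (simp add: has_sum_def)
qed auto

lemma convergent_theta_prod:
  fixes p x :: complex
  assumes "norm p < 1"
  shows "convergent_prod (\<lambda>n. (1 - p ^ n * x) * (1 - p ^ Suc n / x))"
proof -
  have s: "summable (\<lambda>n. norm p ^ n)" using assms by simp
  have "convergent_prod (\<lambda>n. 1 - p ^ n * x)"
  proof (intro abs_convergent_prod_imp_convergent_prod summable_imp_abs_convergent_prod)
    show "summable (\<lambda>n. norm (1 - p ^ n * x - 1))"
      using summable_mult2[OF s, of "norm x"] by (simp add: norm_mult norm_power)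
  qed
  moreover have "convergent_prod (\<lambda>n. 1 - p ^ Suc n / x)"
  proof (intro abs_convergent_prod_imp_convergent_prod summable_imp_abs_convergent_prod)
    show "summable (\<lambda>n. norm (1 - p ^ Suc n / x - 1))"
      using summable_mult2[OF s, of "norm (p / x)"] by (simp add: norm_mult norm_power norm_divide mult_ac)
  qed
  ultimately show ?thesis by (rule convergent_prod_mult)
qed

lemma tendsto_theta_prod:
  assumes "norm p < 1"
  shows "(\<lambda>n. \<Prod>i<n. (1 - p ^ i * x) * (1 - p ^ Suc i / x)) \<longlonglongrightarrow> theta_prod p x"
  unfolding theta_prod_def
  by (intro has_prod_imp_tendsto' convergent_prod_has_prod convergent_theta_prod assms)

text \<open>In this annulus all p^n x and p^(n+1) / x have norm below 1, so no factor
  vanishes.\<close>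

lemma theta_prod_nonzero:
  assumes "norm p < norm x" "norm x < 1"
  shows "theta_prod p x \<noteq> 0"
  unfolding theta_prod_def
proof (rule prodinf_nonzero)
  have p: "norm p < 1" using assms by simp
  show "convergent_prod (\<lambda>n. (1 - p ^ n * x) * (1 - p ^ Suc n / x))"
    by (rule convergent_theta_prod[OF p])
  fix n
  have le: "norm p ^ n \<le> 1" using p by (intro power_le_one) auto
  have "norm (p ^ n * x) < 1"
    using mult_right_mono[OF le, of "norm x"] assms by (simp add: norm_mult norm_power)
  moreover have "norm (p ^ Suc n / x) < 1"
  proof -
    have "norm p * norm p ^ n \<le> norm p" using le by (simp add: mult_left_le)
    also have "\<dots> < norm x" by fact
    finally show ?thesis using assms by (simp add: norm_mult norm_divide norm_power divide_simps)
  qed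
  ultimately show "(1 - p ^ n * x) * (1 - p ^ Suc n / x) \<noteq> 0"
    by (metis less_irrefl mult_eq_0_iff norm_one right_minus_eq)
qed

lemma
  assumes "norm p < 1"
  shows euler_prod_nonzero: "(\<Prod>i. 1 - p ^ Suc i) \<noteq> (0 :: complex)"
    and tendsto_qpoch: "qpoch p \<longlonglongrightarrow> (\<Prod>i. 1 - p ^ Suc i)"
proof -
  have *: "convergent_prod (\<lambda>i. 1 - p ^ Suc i)"
  proof (intro abs_convergent_prod_imp_convergent_prod summable_imp_abs_convergent_prod)
    show "summable (\<lambda>n. norm (1 - p ^ Suc n - 1))"
      using summable_mult[of "\<lambda>n. norm p ^ n" "norm p"] assms by (simp add: norm_mult norm_power)
  qed
  thus "(\<Prod>i. 1 - p ^ Suc i) \<noteq> 0"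
    using one_minus_power_nonzero[OF assms] by (intro prodinf_nonzero) blast+
  show "qpoch p \<longlonglongrightarrow> (\<Prod>i. 1 - p ^ Suc i)"
    unfolding qpoch_def by (intro has_prod_imp_tendsto' convergent_prod_has_prod) fact
qed

text \<open>In the finite triple product the coefficient of each fixed theta term tends to 1 /
  (p;p), and all coefficients are uniformly bounded, so the limit passes through the sum.\<close>

theorem jacobi_triple_product:
  assumes "p \<noteq> 0" "norm p < 1" and x: "x \<noteq> 0"
  shows "theta_series p x = (\<Prod>i. 1 - p ^ Suc i) * theta_prod p x"
proof -
  define L where "L = (\<Prod>i. 1 - p ^ Suc i)"
  have L: "L \<noteq> 0" "qpoch p \<longlonglongrightarrow> L"
    unfolding L_def using assms(2) by (rule euler_prod_nonzero, rule tendsto_qpoch)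
  \<comment> \<open>Extension by 0 beyond |j| = n turns the finite sums into sums over one index
    set.\<close>
  define w where "w n j = (if \<bar>j\<bar> \<le> int n then qbinomial p (2 * n) (nat (j + int n)) else 0)" for n j
  have w: "(\<lambda>n. w n j) \<longlonglongrightarrow> 1 / L" for j
  proof -
    have lim: "(\<lambda>n. qpoch p (g n)) \<longlonglongrightarrow> L" if "filterlim g sequentially sequentially" for g
      by (rule filterlim_compose[OF L(2) that])
    have "(\<lambda>n. qpoch p (2 * n) / (qpoch p (nat (j + int n)) * qpoch p (nat (int n - j)))) \<longlonglongrightarrow> L / (L * L)"
    proof (intro tendsto_intros lim)
      show "filterlim (\<lambda>n. 2 * n) sequentially (sequentially :: nat filter)"
        unfolding filterlim_at_top by (intro allI, rule_tac c = Z in eventually_sequentiallyI) auto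
      show "filterlim (\<lambda>n. nat (j + int n)) sequentially sequentially"
        unfolding filterlim_at_top
        by (intro allI, rule_tac c = "nat (int Z + \<bar>j\<bar>)" in eventually_sequentiallyI) auto
      show "filterlim (\<lambda>n. nat (int n - j)) sequentially sequentially"
        unfolding filterlim_at_top
        by (intro allI, rule_tac c = "nat (int Z + \<bar>j\<bar>)" in eventually_sequentiallyI) auto
    qed (use L in auto)
    moreover have "\<forall>\<^sub>F n in sequentially. qpoch p (2 * n) / (qpoch p (nat (j + int n)) * qpoch p (nat (int n - j))) = w n j"
    proof (intro eventually_sequentiallyI[where c = "nat \<bar>j\<bar>"])
      fix n assume "nat \<bar>j\<bar> \<le> n"
      hence "\<bar>j\<bar> \<le> int n" "nat (j + int n) \<le> 2 * n" "2 * n - nat (j + int n) = nat (int n - j)" by linarith+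
      thus "qpoch p (2 * n) / (qpoch p (nat (j + int n)) * qpoch p (nat (int n - j))) = w n j"
        by (simp add: w_def qbinomial_def)
    qed
    ultimately have "(\<lambda>n. w n j) \<longlonglongrightarrow> L / (L * L)" by (rule Lim_transform_eventually)
    thus ?thesis using L by simp
  qed
  \<comment> \<open>Both \<open>qpoch p\<close> and its reciprocal converge, the latter because
    \<open>L\<close> is nonzero, so a single bound serves all \<open>n\<close> and
    \<open>j\<close>.\<close>
  obtain M where M: "\<And>n j. norm (w n j) \<le> M"
  proof -
    have "Bseq (qpoch p)" using L(2) convergent_imp_Bseq convergentI by blast
    then obtain A where A: "A > 0" "\<And>n. norm (qpoch p n) \<le> A" by (auto simp: Bseq_def)
    have "(\<lambda>n. inverse (qpoch p n)) \<longlonglongrightarrow> inverse L" using L by (intro tendsto_intros)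
    hence "Bseq (\<lambda>n. inverse (qpoch p n))" using convergent_imp_Bseq convergentI by blast
    then obtain C where C: "C > 0" "\<And>n. norm (inverse (qpoch p n)) \<le> C" by (auto simp: Bseq_def)
    have "norm (w n j) \<le> A * (C * C)" for n j
    proof (cases "w n j = 0")
      case True
      thus ?thesis using A C by simp
    next
      case False
      then obtain k l where "w n j = qpoch p (2 * n) * (inverse (qpoch p k) * inverse (qpoch p l))"
        unfolding w_def qbinomial_def by (auto simp: divide_inverse split: if_splits)
      moreover have "norm (qpoch p (2 * n) * (inverse (qpoch p k) * inverse (qpoch p l))) \<le> A * (C * C)"
        using A C unfolding norm_mult by (intro mult_mono mult_nonneg_nonneg) (auto intro: less_imp_le)
      ultimately show ?thesis by simp
    qed
    thus ?thesis using that by blast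
  qed
  have "infsum (\<lambda>j. theta_term p x j * w n j) UNIV = (\<Prod>i<n. (1 - p ^ i * x) * (1 - p ^ Suc i / x))" for n
  proof -
    have "infsum (\<lambda>j. theta_term p x j * w n j) UNIV = infsum (\<lambda>j. theta_term p x j * w n j) {- int n..int n}"
      by (rule infsum_cong_neutral) (auto simp: w_def)
    also have "\<dots> = (\<Sum>j\<in>{- int n..int n}. theta_term p x j * w n j)" by simp
    also have "\<dots> = (\<Sum>k\<le>2 * n. theta_term p x (int k - int n) * qbinomial p (2 * n) k)"
      by (rule sum.reindex_bij_witness[where j = "\<lambda>j. nat (j + int n)" and i = "\<lambda>k. int k - int n"])
         (auto simp: w_def)
    finally show ?thesis using finite_jacobi_triple_product[OF assms] by simp
  qed
  moreover have "(\<lambda>n. infsum (\<lambda>j. theta_term p x j * w n j) UNIV) \<longlonglongrightarrow> infsum (\<lambda>j. theta_term p x j * (1 / L)) UNIV"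
  proof (rule tendsto_infsum_dominated)
    show "(\<lambda>n. theta_term p x j * w n j) \<longlonglongrightarrow> theta_term p x j * (1 / L)" for j
      by (intro tendsto_intros w)
    show "norm (theta_term p x j * w n j) \<le> norm (theta_term p x j) * M" for j n
      using M unfolding norm_mult by (intro mult_left_mono) auto
    show "(\<lambda>j. norm (theta_term p x j) * M) summable_on UNIV"
      by (intro summable_on_cmult_left abs_summable_theta_term assms)
  qed
  ultimately have "theta_prod p x = infsum (\<lambda>j. theta_term p x j * (1 / L)) UNIV"
    using LIMSEQ_unique[OF tendsto_theta_prod[OF assms(2), of x]] by simp
  also have "\<dots> = theta_series p x * (1 / L)"
    unfolding theta_series_def by (rule infsum_cmult_left')
  finally show ?thesis using L(1) unfolding L_def[symmetric] by (simp add: field_simps)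
qed

section \<open>Identities for theta products\<close>

lemma theta_prod_weierstrass:
  assumes "p \<noteq> 0" "norm p < 1" "x \<noteq> 0" "y \<noteq> 0" "u \<noteq> 0" "v \<noteq> 0"
  defines "P \<equiv> theta_prod p"
  shows "P (x * y) * P (x / y) * P (u * v) * P (u / v) - P (x * v) * P (x / v) * P (u * y) * P (u / y)
    = u / y * (P (y * v) * P (y / v) * P (x * u) * P (x / u))"
proof -
  obtain L where L: "L \<noteq> 0" "\<And>x. x \<noteq> 0 \<Longrightarrow> theta_series p x = L * P x"
    using jacobi_triple_product[OF assms(1,2)] euler_prod_nonzero[OF assms(2)] unfolding P_def by blast
  \<comment> \<open>The relation is homogeneous of degree four, so the Euler factor \<open>L\<close>
    cancels.\<close>
  have "L ^ 4 * (P (x * y) * P (x / y) * P (u * v) * P (u / v) - P (x * v) * P (x / v) * P (u * y) * P (u / y))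
    = L ^ 4 * (u / y * (P (y * v) * P (y / v) * P (x * u) * P (x / u)))"
    using theta_series_weierstrass[OF assms(1-6)] assms(3-6)
    by (simp add: L(2) algebra_simps power4_eq_xxxx)
  thus ?thesis using L(1) by (metis mult_cancel_left power_not_zero)
qed

lemma theta_prod_quasiperiod:
  assumes "p \<noteq> 0" "norm p < 1" "x \<noteq> 0"
  shows "theta_prod p (p * x) = - theta_prod p x / x"
proof -
  obtain L where L: "L \<noteq> 0" "\<And>x. x \<noteq> 0 \<Longrightarrow> theta_series p x = L * theta_prod p x"
    using jacobi_triple_product[OF assms(1,2)] euler_prod_nonzero[OF assms(2)] by blast
  have "L * theta_prod p (p * x) = L * (- theta_prod p x / x)"
    using theta_series_quasiperiod[OF assms(1,3)] L(2) assms by simp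
  thus ?thesis using L(1) by (metis mult_cancel_left)
qed

lemma theta_prod_inverse:
  assumes "p \<noteq> 0" "norm p < 1" "x \<noteq> 0"
  shows "theta_prod p (1 / x) = - theta_prod p x / x"
proof -
  obtain L where L: "L \<noteq> 0" "\<And>x. x \<noteq> 0 \<Longrightarrow> theta_series p x = L * theta_prod p x"
    using jacobi_triple_product[OF assms(1,2)] euler_prod_nonzero[OF assms(2)] by blast
  have "L * theta_prod p (1 / x) = L * (- theta_prod p x / x)"
    using theta_series_inverse[OF assms(1,3)] L(2) assms by simp
  thus ?thesis using L(1) by (metis mult_cancel_left)
qed

lemma theta_prod_reflect:
  assumes "p \<noteq> 0" "norm p < 1" "x \<noteq> 0"
  shows "theta_prod p (p / x) = theta_prod p x"
  using theta_prod_quasiperiod[of p "1 / x"] theta_prod_inverse[OF assms] assms by simp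

text \<open>Factor by factor, (1 - a x)(1 + a x) = 1 - a^2 x^2. This handles the passage to 2
  tau.\<close>

lemma theta_prod_square:
  assumes "norm p < 1"
  shows "theta_prod (p ^ 2) (x ^ 2) = theta_prod p x * theta_prod p (- x)"
proof -
  have "theta_prod p x * theta_prod p (- x) = (\<Prod>n. (1 - p ^ n * x) * (1 - p ^ Suc n / x) * ((1 - p ^ n * - x) * (1 - p ^ Suc n / - x)))"
    unfolding theta_prod_def by (intro prodinf_mult convergent_theta_prod assms)
  also have "\<dots> = theta_prod (p ^ 2) (x ^ 2)"
    unfolding theta_prod_def
  proof (rule arg_cong[where f = prodinf], rule ext)
    fix n
    have e: "(p ^ 2) ^ m = (p ^ m) ^ 2" for m by (simp add: mult.commute flip: power_mult)
    have gen: "(1 - a * x) * (1 - b / x) * ((1 - a * - x) * (1 - b / - x)) = (1 - a ^ 2 * x ^ 2) * (1 - b ^ 2 / x ^ 2)" for a b :: complex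
      by (cases "x = 0") (auto simp: field_simps power2_eq_square)
    show "(1 - p ^ n * x) * (1 - p ^ Suc n / x) * ((1 - p ^ n * - x) * (1 - p ^ Suc n / - x)) =
        (1 - (p ^ 2) ^ n * x ^ 2) * (1 - (p ^ 2) ^ Suc n / x ^ 2)"
      unfolding e by (rule gen)
  qed
  finally show ?thesis by simp
qed

text \<open>Even and odd powers of \<open>p\<close> are separated. Factors move only within the
  block of indices 2i and 2i + 1, so the partial products agree exactly. This handles the passage to
  tau / 2.\<close>

lemma theta_prod_split:
  assumes "p \<noteq> 0" "norm p < 1"
  shows "theta_prod p x = theta_prod (p ^ 2) x * theta_prod (p ^ 2) (p * x)"
proof (rule LIMSEQ_unique)
  define f where "f n = (1 - p ^ n * x) * (1 - p ^ Suc n / x)" for n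
  have p2: "norm (p ^ 2) < 1" using assms by (simp add: norm_power power_less_one_iff)
  have pair: "(\<Prod>i<2 * n. f i) = (\<Prod>i<n. f (2 * i) * f (2 * i + 1))" for n
    by (induction n) (simp_all add: mult_ac)
  have e: "(p ^ 2) ^ i = p ^ (2 * i)" for i by (simp flip: power_mult)
  have g: "(1 - a * x) * (1 - a * p ^ 2 / x) * ((1 - a * (p * x)) * (1 - a * p ^ 2 / (p * x))) =
      (1 - a * x) * (1 - a * p / x) * ((1 - a * p * x) * (1 - a * p ^ 2 / x))" for a
  proof -
    have "a * p ^ 2 / (p * x) = a * p / x" using assms by (simp add: power2_eq_square)
    thus ?thesis by (simp only: mult_ac)
  qed
  have "((1 - (p ^ 2) ^ i * x) * (1 - (p ^ 2) ^ Suc i / x)) * ((1 - (p ^ 2) ^ i * (p * x)) * (1 - (p ^ 2) ^ Suc i / (p * x))) =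
      f (2 * i) * f (2 * i + 1)" for i
    using g[of "p ^ (2 * i)"] unfolding e f_def by (simp add: power2_eq_square mult_ac)
  hence "(\<lambda>n. (\<Prod>i<n. (1 - (p ^ 2) ^ i * x) * (1 - (p ^ 2) ^ Suc i / x)) * (\<Prod>i<n. (1 - (p ^ 2) ^ i * (p * x)) * (1 - (p ^ 2) ^ Suc i / (p * x))))
      = (\<lambda>n. \<Prod>i<2 * n. f i)"
    by (simp only: pair prod.distrib[symmetric])
  moreover have "(\<lambda>n. (\<Prod>i<n. (1 - (p ^ 2) ^ i * x) * (1 - (p ^ 2) ^ Suc i / x)) * (\<Prod>i<n. (1 - (p ^ 2) ^ i * (p * x)) * (1 - (p ^ 2) ^ Suc i / (p * x))))
     \<longlonglongrightarrow> theta_prod (p ^ 2) x * theta_prod (p ^ 2) (p * x)"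
    by (intro tendsto_mult tendsto_theta_prod p2)
  ultimately show "(\<lambda>n. \<Prod>i<2 * n. f i) \<longlonglongrightarrow> theta_prod (p ^ 2) x * theta_prod (p ^ 2) (p * x)" by simp
  have "strict_mono (\<lambda>n::nat. 2 * n)" by (simp add: strict_mono_def)
  thus "(\<lambda>n. \<Prod>i<2 * n. f i) \<longlonglongrightarrow> theta_prod p x"
    using LIMSEQ_subseq_LIMSEQ[OF tendsto_theta_prod[OF assms(2), of x]] unfolding f_def o_def by blast
qed

section \<open>Theta values at 14-th parts of the period\<close>

text \<open>Scaling all four variables by a square root of \<open>e\<close> multiplies every product
  by \<open>e\<close> and leaves every quotient alone. The values e = 1, -1, h^7 will relate the
  \<open>a k\<close> to themselves, to the \<open>b k\<close> and to the \<open>c k\<close>.\<close>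

lemma theta_prod_weierstrass_shift:
  assumes "p \<noteq> 0" "norm p < 1" "e \<noteq> 0" "x \<noteq> 0" "y \<noteq> 0" "u \<noteq> 0" "v \<noteq> 0"
  defines "P \<equiv> theta_prod p"
  shows "P (e * (x * y)) * P (x / y) * P (e * (u * v)) * P (u / v) -
      P (e * (x * v)) * P (x / v) * P (e * (u * y)) * P (u / y)
    = u / y * (P (e * (y * v)) * P (y / v) * P (e * (x * u)) * P (x / u))"
proof -
  define w where "w = csqrt e"
  have w: "w \<noteq> 0" using assms by (simp add: w_def)
  have e: "e = w * w" by (simp add: w_def flip: power2_eq_square)
  have *: "w * x * (w * y) = w * w * (x * y)" for x y by simp
  show ?thesis
    using theta_prod_weierstrass[of p "w * x" "w * y" "w * u" "w * v"] assms w
    unfolding P_def e * by simp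
qed

locale nome =
  fixes h :: complex
  assumes h_nonzero: "h \<noteq> 0" and norm_h: "norm h < 1"
begin

abbreviation P :: "complex \<Rightarrow> complex" where "P \<equiv> theta_prod (h ^ 14)"
definition a where "a k = P (h ^ (2 * k))" for k :: nat
definition b where "b k = P (- (h ^ (2 * k)))" for k :: nat
definition c where "c k = P (h ^ (2 * k + 7))" for k :: nat

lemma nome_power: "h ^ 14 \<noteq> 0" "norm (h ^ 14) < 1"
  using h_nonzero norm_h by (auto simp: norm_power power_less_one_iff)

lemma P_nonzero:
  assumes "0 < k" "k < 14"
  shows "P (h ^ k) \<noteq> 0" "P (- (h ^ k)) \<noteq> 0"
proof -
  have "norm (h ^ 14) < norm (h ^ k)" "norm (h ^ k) < 1"
    using assms h_nonzero norm_h by (auto simp: norm_power power_less_one_iff power_strict_decreasing)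
  thus "P (h ^ k) \<noteq> 0" "P (- (h ^ k)) \<noteq> 0" using theta_prod_nonzero by simp_all
qed

lemma abc_nonzero:
  assumes "k \<in> {1, 2, 3}"
  shows "a k \<noteq> 0" "b k \<noteq> 0" "c k \<noteq> 0"
  using assms P_nonzero unfolding a_def b_def c_def by auto

lemma P_reflect:
  assumes "k \<le> 14"
  shows "P (h ^ (14 - k)) = P (h ^ k)" "P (- (h ^ (14 - k))) = P (- (h ^ k))"
  using theta_prod_reflect[OF nome_power, of "h ^ k"] theta_prod_reflect[OF nome_power, of "- (h ^ k)"] assms h_nonzero
  by (simp_all add: power_diff)

lemma P_shift:
  "P (h ^ (14 + k)) = - P (h ^ k) / h ^ k" "P (- (h ^ (14 + k))) = P (- (h ^ k)) / h ^ k"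
  using theta_prod_quasiperiod[OF nome_power, of "h ^ k"] theta_prod_quasiperiod[OF nome_power, of "- (h ^ k)"] h_nonzero
  by (simp_all add: power_add)

lemma P_inverse:
  "P (1 / h ^ k) = - P (h ^ k) / h ^ k" "P (- (1 / h ^ k)) = P (- (h ^ k)) / h ^ k"
  using theta_prod_inverse[OF nome_power, of "h ^ k"] theta_prod_inverse[OF nome_power, of "- (h ^ k)"] h_nonzero
  by simp_all

lemmas P_weierstrass = theta_prod_weierstrass_shift[OF nome_power]

text \<open>Arguments produced by the three-term relation are brought back to k = 1, 2, 3 by
  reflection, quasi-period and inversion.\<close>

lemma P_values:
  "P (h ^ 2) = a 1" "P (h ^ 4) = a 2" "P (h ^ 6) = a 3" "P (h ^ 8) = a 3" "P (h ^ 10) = a 2" "P (h ^ 12) = a 1"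
  "P (- (h ^ 2)) = b 1" "P (- (h ^ 4)) = b 2" "P (- (h ^ 6)) = b 3" "P (- (h ^ 8)) = b 3" "P (- (h ^ 10)) = b 2" "P (- (h ^ 12)) = b 1"
  "P (h ^ 9) = c 1" "P (h ^ 11) = c 2" "P (h ^ 13) = c 3" "P (h ^ 5) = c 1" "P (h ^ 3) = c 2" "P h = c 3"
  "P (h ^ 15) = - c 3 / h" "P (h ^ 17) = - c 2 / h ^ 3"
  "P (1 / h ^ 2) = - a 1 / h ^ 2" "P (- (1 / h ^ 2)) = b 1 / h ^ 2"
  "P (1 / h ^ 11) = - c 2 / h ^ 11" "P (- (1 / h ^ 4)) = b 2 / h ^ 4" "P (- (h ^ 20)) = b 3 / h ^ 6"
  using P_reflect[of 2] P_reflect[of 4] P_reflect[of 6] P_reflect[of 5] P_reflect[of 3] P_reflect[of 1]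
    P_shift[of 1] P_shift[of 3] P_shift[of 6] P_inverse[of 2] P_inverse[of 11] P_inverse[of 4]
  by (simp_all add: a_def b_def c_def)

text \<open>The three-term relation at the multiples 3, 1, 2, 0 of the 7-torsion point h^2. After
  rescaling the coordinates it reads x^3 y + y^3 z + z^3 x = 0.\<close>

lemma klein_quartic: "a 2 ^ 3 * a 3 - h ^ 2 * a 1 ^ 3 * a 2 = a 3 ^ 3 * a 1"
proof -
  have "P (h ^ 8) * P (h ^ 4) * P (h ^ 4) * P (h ^ 4) - P (h ^ 6) * P (h ^ 6) * P (h ^ 6) * P (h ^ 2) =
      h ^ 2 * (P (h ^ 2) * P (h ^ 2) * P (h ^ 10) * P (h ^ 2))"
    using P_weierstrass[of 1 "h ^ 6" "h ^ 2" "h ^ 4" 1] h_nonzero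
    by (simp flip: power_add power_diff)
  thus ?thesis unfolding P_values by (simp add: algebra_simps power2_eq_square power3_eq_cube)
qed

text \<open>The choice e = -1 turns theta values at products into \<open>b\<close> values and keeps
  those at quotients as \<open>a\<close> values, so the relation becomes quadratic in the
  \<open>b k\<close>. Taking y = h^2 and y = h^(-2) gives the two quadrics.\<close>

lemma quadric_b:
  "a 2 ^ 2 * b 2 * b 3 - a 1 * a 3 * b 3 ^ 2 = h ^ 2 * a 1 ^ 2 * b 1 * b 2"
  "a 3 ^ 2 * b 1 * b 3 - a 2 * a 3 * b 2 ^ 2 = h ^ 2 * a 1 ^ 2 * b 1 * b 2"
proof -
  have "P (- (h ^ 8)) * P (h ^ 4) * P (- (h ^ 4)) * P (h ^ 4) - P (- (h ^ 6)) * P (h ^ 6) * P (- (h ^ 6)) * P (h ^ 2) =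
      h ^ 2 * (P (- (h ^ 2)) * P (h ^ 2) * P (- (h ^ 10)) * P (h ^ 2))"
    using P_weierstrass[of "-1" "h ^ 6" "h ^ 2" "h ^ 4" 1] h_nonzero
    by (simp flip: power_add power_diff)
  thus "a 2 ^ 2 * b 2 * b 3 - a 1 * a 3 * b 3 ^ 2 = h ^ 2 * a 1 ^ 2 * b 1 * b 2"
    unfolding P_values by (simp add: algebra_simps power2_eq_square)
  have "P (- (h ^ 4)) * P (h ^ 8) * P (- (h ^ 4)) * P (h ^ 4) - P (- (h ^ 6)) * P (h ^ 6) * P (- (h ^ 2)) * P (h ^ 6) =
      h ^ 6 * (P (- (1 / h ^ 2)) * P (1 / h ^ 2) * P (- (h ^ 10)) * P (h ^ 2))"
    using P_weierstrass[of "-1" "h ^ 6" "1 / h ^ 2" "h ^ 4" 1] h_nonzero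
    by (simp flip: power_add power_diff)
  thus "a 3 ^ 2 * b 1 * b 3 - a 2 * a 3 * b 2 ^ 2 = h ^ 2 * a 1 ^ 2 * b 1 * b 2"
    unfolding P_values using h_nonzero by (simp add: algebra_simps power2_eq_square) (simp add: field_simps eval_nat_numeral)
qed

lemma quadric_c:
  \<comment> \<open>the scaling \<open>(- h)^k\<close> absorbs the quasi-period factor for the shift by the half period \<open>h^7\<close>\<close>
  defines "c1 \<equiv> - h * c 1" and "c2 \<equiv> h ^ 2 * c 2" and "c3 \<equiv> - (h ^ 3) * c 3"
  shows "a 2 ^ 2 * c2 * c3 - a 1 * a 3 * c3 ^ 2 = h ^ 2 * a 1 ^ 2 * c1 * c2"
    and "a 3 ^ 2 * c1 * c3 - a 2 * a 3 * c2 ^ 2 = h ^ 2 * a 1 ^ 2 * c1 * c2"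
proof -
  have "P (h ^ 15) * P (h ^ 4) * P (h ^ 11) * P (h ^ 4) - P (h ^ 13) * P (h ^ 6) * P (h ^ 13) * P (h ^ 2) =
      h ^ 2 * (P (h ^ 9) * P (h ^ 2) * P (h ^ 17) * P (h ^ 2))"
    using P_weierstrass[of "h ^ 7" "h ^ 6" "h ^ 2" "h ^ 4" 1] h_nonzero
    by (simp flip: power_add power_diff)
  thus "a 2 ^ 2 * c2 * c3 - a 1 * a 3 * c3 ^ 2 = h ^ 2 * a 1 ^ 2 * c1 * c2"
    unfolding P_values c1_def c2_def c3_def using h_nonzero
    by (simp add: field_simps) (simp add: algebra_simps eval_nat_numeral)
  have "P (h ^ 11) * P (h ^ 8) * P (h ^ 11) * P (h ^ 4) - P (h ^ 13) * P (h ^ 6) * P (h ^ 9) * P (h ^ 6) =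
      h ^ 6 * (P (h ^ 5) * P (1 / h ^ 2) * P (h ^ 17) * P (h ^ 2))"
    using P_weierstrass[of "h ^ 7" "h ^ 6" "1 / h ^ 2" "h ^ 4" 1] h_nonzero
    by (simp flip: power_add power_diff)
  also have "\<dots> = h * a 1 ^ 2 * c 1 * c 2"
    unfolding P_values using h_nonzero by (simp add: field_simps eval_nat_numeral)
  finally show "a 3 ^ 2 * c1 * c3 - a 2 * a 3 * c2 ^ 2 = h ^ 2 * a 1 ^ 2 * c1 * c2"
    unfolding P_values c1_def c2_def c3_def by algebra
qed

text \<open>Up to a nonzero factor this expression is the difference of the roots \<open>t\<close>
  and \<open>s\<close>. It divides one side of a three-term relation whose other side is a product
  of theta values at h^12, -h^9 and -h^7, all nonzero.\<close>

lemma b_c_distinct: "h * b 2 * c 3 + b 3 * c 2 \<noteq> 0"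
proof
  assume 0: "h * b 2 * c 3 + b 3 * c 2 = 0"
  have quot: "h ^ 8 / h ^ 12 = 1 / h ^ 4" "h / h ^ 12 = 1 / h ^ 11" "h ^ 8 / h = h ^ 7"
      "h * z / h ^ 12 = z / h ^ 11" for z
    using h_nonzero by (simp_all add: field_simps eval_nat_numeral)
  have "P (- (h ^ 20)) * P (- (1 / h ^ 4)) * P h * P h - P (- (h ^ 8)) * P (- (h ^ 8)) * P (h ^ 13) * P (1 / h ^ 11) =
      1 / h ^ 11 * (P (h ^ 12) * P (h ^ 12) * P (- (h ^ 9)) * P (- (h ^ 7)))"
    using theta_prod_weierstrass[OF nome_power, of "- (h ^ 8)" "h ^ 12" h 1] h_nonzero
    by (simp add: quot flip: power_add power_Suc power_Suc2)
  hence "1 / h ^ 11 * (a 1 * a 1 * P (- (h ^ 9)) * P (- (h ^ 7))) =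
      b 3 / h ^ 6 * (b 2 / h ^ 4) * c 3 * c 3 - b 3 * b 3 * c 3 * (- c 2 / h ^ 11)"
    unfolding P_values by simp
  also have "\<dots> = b 3 * c 3 * (h * b 2 * c 3 + b 3 * c 2) / h ^ 11"
    using h_nonzero by (simp add: field_simps eval_nat_numeral)
  finally show False using 0 abc_nonzero[of 1] P_nonzero[of 9] P_nonzero[of 7] h_nonzero by simp
qed

end

section \<open>Elimination and the cubic\<close>

lemma cubic_of_quadrics:
  fixes a1 a2 a3 b1 b2 b3 q :: complex
  assumes nz: "a1 \<noteq> 0" "a2 \<noteq> 0" "a3 \<noteq> 0" "b1 \<noteq> 0" "b2 \<noteq> 0" "b3 \<noteq> 0" "q \<noteq> 0"
  assumes R1: "a2 ^ 2 * b2 * b3 - a1 * a3 * b3 ^ 2 = q * a1 ^ 2 * b1 * b2"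
      and R2: "a3 ^ 2 * b1 * b3 - a2 * a3 * b2 ^ 2 = q * a1 ^ 2 * b1 * b2"
  defines "t \<equiv> a3 * b2 / (a2 * b3)" and "n \<equiv> a3 ^ 3 / (q * a1 ^ 2 * a2)" and "m \<equiv> a1 * a3 ^ 2 / a2 ^ 3"
  shows "t ^ 3 + (t - m) * (t - n) = 0" "a3 ^ 2 * b1 / (a2 ^ 2 * b2) = n * (t - m) / t ^ 2"
proof -
  \<comment> \<open>Multiplying \<open>R1\<close> by the cofactor of \<open>b1\<close> in
    \<open>R2\<close> eliminates \<open>b1\<close> and leaves an equation between binary cubic forms
    in \<open>b2\<close> and \<open>b3\<close>.\<close>
  have "(a2 ^ 2 * b2 - a1 * a3 * b3) * b3 * (a3 ^ 2 * b3 - q * a1 ^ 2 * b2) =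
      (q * a1 ^ 2 * b2) * (b1 * (a3 ^ 2 * b3 - q * a1 ^ 2 * b2))"
    using R1 by (simp add: algebra_simps power2_eq_square)
  also have "b1 * (a3 ^ 2 * b3 - q * a1 ^ 2 * b2) = a2 * a3 * b2 ^ 2"
    using R2 by (simp add: algebra_simps)
  finally have E: "(a2 ^ 2 * b2 - a1 * a3 * b3) * b3 * (a3 ^ 2 * b3 - q * a1 ^ 2 * b2) =
    q * a1 ^ 2 * b2 * (a2 * a3 * b2 ^ 2)" .
  \<comment> \<open>The numbers \<open>m\<close> and \<open>n\<close> are the values of
    \<open>t\<close> at which the two linear factors in \<open>E\<close> vanish.\<close>
  have tm: "t - m = a3 * (a2 ^ 2 * b2 - a1 * a3 * b3) / (a2 ^ 3 * b3)"
    using nz by (simp add: t_def m_def field_simps eval_nat_numeral)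
  have tn: "t - n = - a3 * (a3 ^ 2 * b3 - q * a1 ^ 2 * b2) / (q * a1 ^ 2 * a2 * b3)"
    using nz by (simp add: t_def n_def field_simps eval_nat_numeral)
  have "(t - m) * (t - n) = - (a3 ^ 2 * ((a2 ^ 2 * b2 - a1 * a3 * b3) * b3 * (a3 ^ 2 * b3 - q * a1 ^ 2 * b2))) / (q * a1 ^ 2 * a2 ^ 4 * b3 ^ 3)"
    unfolding tm tn by (simp add: eval_nat_numeral mult_ac)
  also have "\<dots> = - (t ^ 3)"
    unfolding E t_def using nz by (simp add: field_simps eval_nat_numeral)
  finally show "t ^ 3 + (t - m) * (t - n) = 0" by simp
  \<comment> \<open>For the second claim \<open>R1\<close> is solved for the eliminated
    \<open>b1\<close>.\<close>
  have "q * a1 ^ 2 * b1 * b2 = (a2 ^ 2 * b2 - a1 * a3 * b3) * b3"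
    using R1 by (simp add: algebra_simps power2_eq_square)
  hence "b1 = (a2 ^ 2 * b2 - a1 * a3 * b3) * b3 / (q * a1 ^ 2 * b2)"
    using nz by (simp add: field_simps)
  moreover have "a3 ^ 2 * (D * b3 / (q * a1 ^ 2 * b2)) / (a2 ^ 2 * b2) = n * (a3 * D / (a2 ^ 3 * b3)) / t ^ 2" for D
    unfolding t_def n_def using nz by (simp add: field_simps eval_nat_numeral)
  ultimately show "a3 ^ 2 * b1 / (a2 ^ 2 * b2) = n * (t - m) / t ^ 2"
    unfolding tm by metis
qed

text \<open>The cubic is T^3 + T^2 - (m + n) T + m n, with distinct roots \<open>t\<close> and
  \<open>s\<close>. The point is that \<open>z\<close> equals \<open>s\<close>; the sum -1 then
  makes \<open>y\<close> the third root, and the claims are Vieta's formulas.\<close>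

lemma cubic_symmetric_functions:
  fixes t s m n X :: complex
  assumes nz: "t \<noteq> 0" "s \<noteq> 0" "s \<noteq> t"
  assumes t: "t ^ 3 + (t - m) * (t - n) = 0" and s: "s ^ 3 + (s - m) * (s - n) = 0"
  assumes X: "X = - (m * s ^ 2 / (t * (s - m)))"
  defines "y \<equiv> X - m / t" and "z \<equiv> - X - n * (t - m) / t ^ 2"
  shows "t + y + z = -1" "t * y + y * z + z * t = - (m + n)" "t * y * z = - (m * n)"
proof -
  have sm: "s - m \<noteq> 0" using s nz by auto
  \<comment> \<open>Subtracting the two cubic equations leaves the factor s - t, whose cofactor is
    the relation \<open>Q\<close> between distinct roots.\<close>
  have "(s - t) * (s ^ 2 + s * t + t ^ 2 + s + t - (m + n)) = 0"
    using s t by algebra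
  hence Q: "s ^ 2 + s * t + t ^ 2 + s + t - (m + n) = 0" using nz by simp
  \<comment> \<open>This is the cubic for \<open>t\<close> divided by t^2; \<open>X\<close> cancels
    from y + z.\<close>
  have 1: "t - m / t - n * (t - m) / t ^ 2 = -1"
  proof -
    have "t - m / t - n * (t - m) / t ^ 2 + 1 = (t ^ 3 + (t - m) * (t - n)) / t ^ 2"
      using nz by (simp add: field_simps power2_eq_square power3_eq_cube)
    thus ?thesis unfolding t by (simp add: add_eq_0_iff2)
  qed
  show e1: "t + y + z = -1" using 1 unfolding y_def z_def by algebra
  have X': "X = m * (s - n) / (t * s)"
  proof -
    have "s ^ 2 * s = - ((s - m) * (s - n))" using s by algebra
    thus ?thesis using sm nz unfolding X
      by (simp add: field_simps) algebra
  qed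
  \<comment> \<open>The third root being -1 - s - t, this is the formula for the product of the
    roots.\<close>
  have P: "s * t * (1 + s + t) = m * n" using Q t by algebra
  \<comment> \<open>The left side is the numerator of z - s up to sign.\<close>
  have "s * t * (s * t) + (m + n) * (s * t) - m * n * (s + t) = 0"
    using Q P by algebra
  moreover have "z - s = - (s * t * (s * t) + (m + n) * (s * t) - m * n * (s + t)) / (s * t ^ 2)"
    unfolding z_def X' using nz by (simp add: field_simps power2_eq_square)
  ultimately have z: "z = s" by simp
  have y: "y = -1 - s - t" using e1 z by (simp add: algebra_simps)
  show "t * y + y * z + z * t = - (m + n)" unfolding y z using Q by algebra
  show "t * y * z = - (m * n)" unfolding y z using P by algebra
qed

section \<open>The functions \<open>phi1\<close> and \<open>phi2\<close>\<close>

text \<open>Expanding the square, (14n + 7 - 2k)^2 / 28 = (7 - 2k)^2 / 28 + 7n(n + 1) - 2kn, and the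
  last two terms are the exponents of \<open>h\<close> in the theta term of index -n.\<close>

lemma a7_eq_theta_series:
  fixes \<tau> :: complex
  defines "h \<equiv> exp (of_real pi * \<i> * \<tau>)"
  shows "a7 k \<tau> = (-1) ^ (k + 1) * exp (of_real pi * \<i> * \<tau> * (7 - 2 * of_nat k) ^ 2 / 28) * theta_series (h ^ 14) (h ^ (2 * k))"
proof -
  define c where "c = (-1) ^ (k + 1) * exp (of_real pi * \<i> * \<tau> * (7 - 2 * of_nat k) ^ 2 / 28)"
  have "a7 k \<tau> = (\<Sum>\<^sub>\<infinity>n. c * theta_term (h ^ 14) (h ^ (2 * k)) n)"
    unfolding a7_explicit
  proof (rule infsum_reindex_bij_witness[where i = "\<lambda>n. - n" and j = "\<lambda>n. - n"])
    fix n :: int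
    have hp: "(h ^ m) powi l = exp (of_real pi * \<i> * \<tau> * of_nat m * of_int l)" for m l
      unfolding h_def exp_of_nat_mult[symmetric] exp_power_int by (simp only: mult_ac)
    have "14 * (- n * (- n - 1) div 2) = 7 * (n * (n + 1))"
    proof -
      have "- n * (- n - 1) = n * (n + 1)" by algebra
      moreover have "2 * (n * (n + 1) div 2) = n * (n + 1)" by simp
      ultimately show ?thesis by presburger
    qed
    hence d: "14 * of_int (- n * (- n - 1) div 2) = (7 * (of_int n * (of_int n + 1)) :: complex)"
      by (metis of_int_mult of_int_add of_int_1 of_int_numeral)
    have s: "(-1) powi (n + int k + 1) = (-1) ^ (k + 1) * ((-1) powi (- n) :: complex)"
      by (simp add: power_int_add power_int_minus_left)
    define z where "z = of_real pi * \<i> * \<tau>"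
    have "z * of_nat 14 * of_int (- n * (- n - 1) div 2) = z * (7 * (of_int n * (of_int n + 1)))"
      unfolding d[symmetric] by simp
    hence E: "exp (z * (7 - 2 * of_nat k) ^ 2 / 28) * exp (z * of_nat 14 * of_int (- n * (- n - 1) div 2)) * exp (z * of_nat (2 * k) * of_int (- n)) =
        exp (z * ((7 - 2 * of_nat k) ^ 2 / 28 + 7 * (of_int n * (of_int n + 1)) - 2 * of_nat k * of_int n))"
      by (simp only: exp_add[symmetric]) (simp add: algebra_simps)
    have "c * theta_term (h ^ 14) (h ^ (2 * k)) (- n) =
      (-1) powi (n + int k + 1) * exp (of_real pi * \<i> * \<tau> * ((7 - 2 * of_nat k) ^ 2 / 28 + 7 * (of_int n * (of_int n + 1)) - 2 * of_nat k * of_int n))"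
      unfolding theta_term_def hp c_def s z_def[symmetric] E[symmetric] by (simp only: mult_ac)
    also have "of_real pi * \<i> * \<tau> * ((7 - 2 * of_nat k) ^ 2 / 28 + 7 * (of_int n * (of_int n + 1)) - 2 * of_nat k * of_int n) =
      2 * of_real pi * \<i> * of_real (of_int ((14 * n + 7 - 2 * int k)\<^sup>2) / 56) * \<tau>"
      by (simp add: power2_eq_square field_simps)
    finally show "c * theta_term (h ^ 14) (h ^ (2 * k)) (- n) = (-1) powi (n + int k + 1) * exp (2 * of_real pi * \<i> * of_real (of_int ((14 * n + 7 - 2 * int k)\<^sup>2) / 56) * \<tau>)" .
  qed auto
  also have "\<dots> = c * theta_series (h ^ 14) (h ^ (2 * k))"
    unfolding theta_series_def by (rule infsum_cmult_right')
  finally show ?thesis by (simp add: c_def)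
qed

lemma norm_exp_less_1:
  assumes "Im \<tau> > 0"
  shows "norm (exp (of_real pi * \<i> * \<tau>)) < 1"
  using assms by (simp add: norm_exp_eq_Re)

text \<open>Signs and Euler factors cancel in the quotients. Since (7 - 2k)^2 is 25, 9, 1 for k = 1,
  2, 3, the leading exponents differ by -8/28 and -16/28.\<close>

lemma phi_eq_theta_prod:
  fixes \<tau> :: complex
  assumes "Im \<tau> > 0"
  defines "z \<equiv> of_real pi * \<i> * \<tau>"
  defines "P \<equiv> theta_prod (exp z ^ 14)"
  shows "phi1 \<tau> = exp (- 2 * z / 7) * (P (exp z ^ 6) / P (exp z ^ 4))"
    and "phi2 \<tau> = exp (- 4 * z / 7) * (P (exp z ^ 4) / P (exp z ^ 2))"
proof -
  have h: "norm (exp z) < 1" using norm_exp_less_1[OF assms(1)] by (simp add: z_def)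
  have p: "exp z ^ 14 \<noteq> 0" "norm (exp z ^ 14) < 1"
    using h by (auto simp: norm_power power_less_one_iff simp del: norm_exp_eq_Re)
  define L where "L = (\<Prod>i. 1 - (exp z ^ 14) ^ Suc i)"
  have L: "L \<noteq> 0" unfolding L_def by (rule euler_prod_nonzero[OF p(2)])
  have a: "a7 k \<tau> = (-1) ^ (k + 1) * exp (z * (7 - 2 * of_nat k) ^ 2 / 28) * (L * P (exp z ^ (2 * k)))" for k
    unfolding a7_eq_theta_series z_def[symmetric] P_def L_def
    by (subst jacobi_triple_product[OF p]) auto
  have a: "a7 1 \<tau> = exp (z * 25 / 28) * (L * P (exp z ^ 2))" "a7 2 \<tau> = - (exp (z * 9 / 28) * (L * P (exp z ^ 4)))"
    "a7 3 \<tau> = exp (z / 28) * (L * P (exp z ^ 6))"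
    using a[of 1] a[of 2] a[of 3] by simp_all
  have e: "exp (z / 28) / exp (z * 9 / 28) = exp (- 2 * z / 7)" "exp (z * 9 / 28) / exp (z * 25 / 28) = exp (- 4 * z / 7)"
    by (simp_all add: field_simps flip: exp_diff)
  show "phi1 \<tau> = exp (- 2 * z / 7) * (P (exp z ^ 6) / P (exp z ^ 4))"
    unfolding phi1_def a e[symmetric] using L by simp
  show "phi2 \<tau> = exp (- 4 * z / 7) * (P (exp z ^ 4) / P (exp z ^ 2))"
    unfolding phi2_def a e[symmetric] using L by simp
qed

lemma phi_in_nome:
  fixes \<tau> :: complex
  assumes "Im \<tau> > 0"
  defines "z \<equiv> of_real pi * \<i> * \<tau>"
  defines "h \<equiv> exp z"
  shows "phi1 \<tau> = exp (- 2 * z / 7) * (nome.a h 3 / nome.a h 2)"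
    and "phi2 \<tau> = exp (- 4 * z / 7) * (nome.a h 2 / nome.a h 1)"
    and "phi1 (2 * \<tau>) = exp (- 4 * z / 7) * (nome.a h 3 * nome.b h 3 / (nome.a h 2 * nome.b h 2))"
    and "phi2 (2 * \<tau>) = exp (- 8 * z / 7) * (nome.a h 2 * nome.b h 2 / (nome.a h 1 * nome.b h 1))"
    and "phi1 (\<tau> / 2) = exp (- z / 7) * (nome.a h 2 * nome.c h 2 / (nome.a h 1 * nome.c h 1))"
proof -
  interpret nome h
    using norm_exp_less_1[OF assms(1)] by unfold_locales (auto simp: h_def z_def)
  show "phi1 \<tau> = exp (- 2 * z / 7) * (a 3 / a 2)" "phi2 \<tau> = exp (- 4 * z / 7) * (a 2 / a 1)"
    using phi_eq_theta_prod[OF assms(1)] unfolding z_def[symmetric] h_def[symmetric] P_values by simp_all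
  have h2: "exp (2 * z) = h ^ 2"
    by (simp add: h_def flip: exp_of_nat_mult)
  \<comment> \<open>Passing to 2 tau squares exp(pi i tau), hence both the nome and the
    argument.\<close>
  have sq: "theta_prod ((h ^ 2) ^ 14) ((h ^ 2) ^ k) = P (h ^ k) * P (- (h ^ k))" for k
    using theta_prod_square[OF nome_power(2), of "h ^ k"] by (simp flip: power_mult add: mult.commute)
  have z2: "of_real pi * \<i> * (2 * \<tau>) = 2 * z" by (simp add: z_def)
  have "Im (2 * \<tau>) > 0" using assms by simp
  from phi_eq_theta_prod[OF this]
  show "phi1 (2 * \<tau>) = exp (- 4 * z / 7) * (a 3 * b 3 / (a 2 * b 2))"
    "phi2 (2 * \<tau>) = exp (- 8 * z / 7) * (a 2 * b 2 / (a 1 * b 1))"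
    unfolding z2 h2 sq P_values by simp_all
  \<comment> \<open>Passing to tau / 2 replaces \<open>h\<close> by its square root
    \<open>k\<close>. The nome becomes h^7, and splitting the product returns to nome h^14 with an
    extra factor translated by the half period h^7.\<close>
  define k where "k = exp (z / 2)"
  have k: "of_real pi * \<i> * (\<tau> / 2) = z / 2" "exp (z / 2) = k" by (simp_all add: z_def k_def)
  have kh: "k ^ 2 = h" unfolding k_def h_def by (simp flip: exp_of_nat_mult)
  have pw: "k ^ 14 = h ^ 7" "k ^ 6 = h ^ 3" "k ^ 4 = h ^ 2" by (simp_all flip: kh power_mult)
  have "norm (h ^ 7) < 1" using norm_h by (simp add: norm_power power_less_one_iff)
  hence "theta_prod (h ^ 7) (h ^ j) = P (h ^ j) * P (h ^ (7 + j))" for j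
    using theta_prod_split[of "h ^ 7" "h ^ j"] h_nonzero by (simp flip: power_mult add: power_add)
  from this[of 2] this[of 3] have sp: "theta_prod (h ^ 7) (h ^ 2) = a 1 * c 1" "theta_prod (h ^ 7) (h ^ 3) = a 2 * c 2"
    by (simp_all add: P_values)
  have "Im (\<tau> / 2) > 0" using assms by simp
  from phi_eq_theta_prod(1)[OF this]
  show "phi1 (\<tau> / 2) = exp (- z / 7) * (a 2 * c 2 / (a 1 * c 1))"
    unfolding k pw sp by simp
qed

theorem theorem1p1:
  fixes \<tau> :: complex
  assumes "Im \<tau> > 0"
  shows "P_poly (upsilon \<tau>) = [: - g1 \<tau>, 1 :] * [: - g2 \<tau>, 1 :] * [: - g3 \<tau>, 1 :]
    \<and> g1 \<tau> + g2 \<tau> + g3 \<tau> = -1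
    \<and> g1 \<tau> * g2 \<tau> + g2 \<tau> * g3 \<tau> + g3 \<tau> * g1 \<tau> = - upsilon \<tau> + 1 / upsilon \<tau>
    \<and> g1 \<tau> * g2 \<tau> * g3 \<tau> = - upsilon \<tau> - 1 / upsilon \<tau> + 2"
proof -
  define z where "z = of_real pi * \<i> * \<tau>"
  define h where "h = exp z"
  \<comment> \<open>A seventh root of 1 / h, in which all exponential prefactors are powers.\<close>
  define w where "w = exp (- z / 7)"
  interpret nome h
    using norm_exp_less_1[OF assms] by unfold_locales (auto simp: h_def z_def)
  note nz = abc_nonzero[of 1, simplified] abc_nonzero[of 2, simplified] abc_nonzero[of 3, simplified] h_nonzero
  have w: "w \<noteq> 0" "w ^ 7 * h = 1"
    by (simp_all add: w_def h_def flip: exp_of_nat_mult exp_add)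
  have ew: "exp (- 2 * z / 7) = w ^ 2" "exp (- 4 * z / 7) = w ^ 4" "exp (- 8 * z / 7) = w ^ 8" "exp (- z / 7) = w"
    by (simp_all add: w_def flip: exp_of_nat_mult)
  note phi = phi_in_nome[OF assms, folded z_def, folded h_def, unfolded ew]

  define n where "n = a 3 ^ 3 / (h ^ 2 * a 1 ^ 2 * a 2)"
  define m where "m = a 1 * a 3 ^ 2 / a 2 ^ 3"
  define t where "t = a 3 * b 2 / (a 2 * b 3)"
  \<comment> \<open>The same ratio as \<open>t\<close>, with each \<open>b k\<close> replaced by
    (-h)^k times \<open>c k\<close>.\<close>
  define s where "s = a 3 * (h ^ 2 * c 2) / (a 2 * (- (h ^ 3) * c 3))"
  define X where "X = a 3 ^ 2 * b 3 * c 2 / (h * (a 1 * a 2 * b 2 * c 1))"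
  define u where "u = a 2 ^ 2 * a 3 / (h ^ 2 * a 1 ^ 3)"

  have h_inv: "1 / h = w ^ 7" using w h_nonzero by (simp add: field_simps)
  have u: "upsilon \<tau> = u"
  proof -
    have "upsilon \<tau> = (w ^ 7) ^ 2 * (a 2 ^ 2 * a 3 / a 1 ^ 3)"
      unfolding upsilon_eq_phi phi using nz by (simp add: field_simps eval_nat_numeral)
    also have "\<dots> = u" unfolding h_inv[symmetric] u_def by (simp add: power_divide)
    finally show ?thesis .
  qed
  have X: "phi1 \<tau> * phi1 (\<tau> / 2) * phi1 (2 * \<tau>) = X"
  proof -
    have "phi1 \<tau> * phi1 (\<tau> / 2) * phi1 (2 * \<tau>) = w ^ 7 * (a 3 ^ 2 * b 3 * c 2 / (a 1 * a 2 * b 2 * c 1))"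
      unfolding phi using nz by (simp add: field_simps eval_nat_numeral)
    also have "\<dots> = X" unfolding h_inv[symmetric] X_def by simp
    finally show ?thesis .
  qed

  have cubic_t: "t ^ 3 + (t - m) * (t - n) = 0" and Z: "a 3 ^ 2 * b 1 / (a 2 ^ 2 * b 2) = n * (t - m) / t ^ 2"
    unfolding t_def m_def n_def 
    by (rule cubic_of_quadrics[of "a 1" "a 2" "a 3" "b 1"]; use nz quadric_b in simp)+
  have cubic_s: "s ^ 3 + (s - m) * (s - n) = 0"
    and c1: "a 3 ^ 2 * (- h * c 1) / (a 2 ^ 2 * (h ^ 2 * c 2)) = n * (s - m) / s ^ 2"
    unfolding s_def m_def n_def 
    by (rule cubic_of_quadrics[of "a 1" "a 2" "a 3" "- h * c 1"]; use nz quadric_c in simp)+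
  have t0: "t \<noteq> 0" and s0: "s \<noteq> 0" and n0: "n \<noteq> 0" using nz by (simp_all add: t_def s_def n_def)
  have "s \<noteq> t"
  proof
    assume "s = t"
    moreover have "t - s = a 3 * (h * b 2 * c 3 + b 3 * c 2) / (h * a 2 * b 3 * c 3)"
      using nz by (simp add: s_def t_def field_simps eval_nat_numeral)
    ultimately show False using b_c_distinct nz by simp
  qed
  have sm: "s - m \<noteq> 0" using cubic_s s0 by auto
  \<comment> \<open>The second output of the elimination for the rescaled \<open>c k\<close>,
    inverted, expresses the quotient c 2 / c 1 inside \<open>X\<close> through
    \<open>s\<close>.\<close>
  have X_s: "X = - (m * s ^ 2 / (t * (s - m)))"
  proof -
    have "s ^ 2 / (s - m) = n * (a 2 ^ 2 * (h ^ 2 * c 2)) / (a 3 ^ 2 * (- h * c 1))"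
      using c1 sm s0 nz by (simp add: field_simps)
    hence "- (m * s ^ 2 / (t * (s - m))) = - (m / t * (n * (a 2 ^ 2 * (h ^ 2 * c 2)) / (a 3 ^ 2 * (- h * c 1))))"
      by (metis times_divide_times_eq)
    also have "\<dots> = X"
      unfolding m_def t_def n_def X_def using nz by (simp add: field_simps eval_nat_numeral)
    finally show ?thesis by simp
  qed

  have g: "g1 \<tau> = t" "g2 \<tau> = X - m / t" "g3 \<tau> = - X - n * (t - m) / t ^ 2"
  proof -
    show "g1 \<tau> = t" unfolding g1_def phi t_def using nz w(1) by (simp add: field_simps eval_nat_numeral)
    have "phi1 (2 * \<tau>) / phi2 \<tau> = m / t"
      unfolding phi m_def t_def using nz w(1) by (simp add: field_simps eval_nat_numeral)
    thus "g2 \<tau> = X - m / t" unfolding g2_def X by simp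
    have "phi1 \<tau> ^ 2 * phi2 \<tau> / phi2 (2 * \<tau>) = a 3 ^ 2 * b 1 / (a 2 ^ 2 * b 2)"
      unfolding phi using nz w(1) by (simp add: field_simps eval_nat_numeral)
    thus "g3 \<tau> = - X - n * (t - m) / t ^ 2" unfolding g3_def X Z by simp
  qed
  note sym = cubic_symmetric_functions[OF t0 s0 \<open>s \<noteq> t\<close> cubic_t cubic_s X_s, folded g]

  have u0: "u \<noteq> 0" using nz by (simp add: u_def)
  \<comment> \<open>Klein's quartic, divided by h^2 a1^3 a2, is exactly this identity.\<close>
  have n_u: "n = u - 1"
  proof -
    have "u - 1 = (a 2 ^ 3 * a 3 - h ^ 2 * a 1 ^ 3 * a 2) / (h ^ 2 * a 1 ^ 3 * a 2)"
      unfolding u_def using nz by (simp add: field_simps eval_nat_numeral)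
    also have "\<dots> = n"
      unfolding klein_quartic n_def using nz by (simp add: field_simps eval_nat_numeral)
    finally show ?thesis by simp
  qed
  have "m = n / u" unfolding m_def n_def u_def using nz by (simp add: field_simps eval_nat_numeral)
  hence m_u: "m = (u - 1) / u" by (simp add: n_u)
  have e1: "g1 \<tau> + g2 \<tau> + g3 \<tau> = -1" by (rule sym(1))
  have e2: "g1 \<tau> * g2 \<tau> + g2 \<tau> * g3 \<tau> + g3 \<tau> * g1 \<tau> = - u + 1 / u"
    using sym(2) u0 by (simp add: n_u m_u field_simps)
  have e3: "g1 \<tau> * g2 \<tau> * g3 \<tau> = - u - 1 / u + 2"
    using sym(3) u0 by (simp add: n_u m_u field_simps)
  have "P_poly u = [: - (- u - 1 / u + 2), - u + 1 / u, - (-1), 1 :]"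
    using u0 by (simp add: P_poly_def field_simps power2_eq_square)
  also have "\<dots> = [: - g1 \<tau>, 1 :] * [: - g2 \<tau>, 1 :] * [: - g3 \<tau>, 1 :]"
    unfolding e1[symmetric] e2[symmetric] e3[symmetric] by (simp add: algebra_simps)
  finally show ?thesis unfolding u using e1 e2 e3 by simp
qed

end
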